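(* Let $m\ge p$, let $Y\in\mathbb{C}^{m\times p}$ have orthonormal columns, and let $H\in T_Y Gr(p,m)$. Then, for any integer $n\ge 0$, $$\mathrm{Exp}^{Gr}_Y(tH)=\mathcal{P}\left(Y\alpha_n(t^2H^*H)+tH\beta_n(t^2H^*H)\right)+O\left(t^{2n+1}\right),$$ where $$\alpha_n(z)=\sum_{j=0}^{\lfloor n/2\rfloor}a_{2j}(-z)^j,\qquad \beta_n(z)=\sum_{j=0}^{\lfloor (n-1)/2\rfloor}a_{2j+1}(-z)^j,$$ and $$a_k=\binom{n}{k}\frac{(2n-k)!}{(2n)!}2^k,\quad k=0,1,\dots,n.$$
   Context: $Gr(p,m)$ is the Grassmannian manifold of $p$-dimensional subspaces of $\mathbb{C}^m$; a subspace is represented by a matrix $Y\in\mathbb{C}^{m\times p}$ with orthonormal columns spanning it. With this representation, $T_YGr(p,m)=\{Y_\perp K\mid K\in\mathbb{C}^{(m-p)\times p}\}$, where $Y_\perp\in\mathbb{C}^{m\times(m-p)}$ is any matrix such that $\begin{pmatrix}Y&Y_\perp\end{pmatrix}$ is unitary. For $H=Y_\perp K$, the Riemannian exponential (with respect to the canonical metric) is represented by the matrix $$\mathrm{Exp}^{Gr}_Y H=\begin{pmatrix}Y&Y_\perp\end{pmatrix}\exp\begin{pmatrix}0&-K^* \\ K&0\end{pmatrix}\begin{pmatrix}I \\ 0\end{pmatrix}\in\mathbb{C}^{m\times p}.$$ For a full-rank matrix $A\in\mathbb{C}^{m\times p}$ ($m\ge p$), $\mathcal{P}(A)=U$ denotes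 the factor in the polar decomposition $A=UH$, where $U\in\mathbb{C}^{m\times p}$ has orthonormal columns and $H\in\mathbb{C}^{p\times p}$ is Hermitian positive-definite. Here $t$ is a real scalar, $O(\cdot)$ is understood in the Frobenius norm as $t\to0$, with implied constant depending on the other data, and for $t$ sufficiently small the argument of $\mathcal{P}$ has full rank. Empty sums are zero. *)

theory Defs
  imports
    "Jordan_Normal_Form.Schur_Decomposition"
    "HOL-Library.Landau_Symbols"
begin

definition orthonormal_cols :: "complex mat \<Rightarrow> bool" where
  "orthonormal_cols A \<longleftrightarrow> mat_adjoint A * A = 1\<^sub>m (dim_col A)"

definition unitary_mat :: "complex mat \<Rightarrow> bool" where
  "unitary_mat A \<longleftrightarrow> square_mat A \<and>
     mat_adjoint A * A = 1\<^sub>m (dim_row A) \<and> A * mat_adjoint A = 1\<^sub>m (dim_row A)"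

definition hermitian_mat :: "complex mat \<Rightarrow> bool" where
  "hermitian_mat A \<longleftrightarrow> square_mat A \<and> mat_adjoint A = A"

text \<open>For Hermitian \<open>A\<close> the quadratic form is automatically real, so taking \<open>Re\<close> loses nothing.\<close>

definition hermitian_posdef_mat :: "complex mat \<Rightarrow> bool" where
  "hermitian_posdef_mat A \<longleftrightarrow> hermitian_mat A \<and>
     (\<forall>v \<in> carrier_vec (dim_row A). v \<noteq> 0\<^sub>v (dim_row A) \<longrightarrow> Re ((A *\<^sub>v v) \<bullet>c v) > 0)"

definition frob_norm :: "complex mat \<Rightarrow> real" where
  "frob_norm A = sqrt (\<Sum>i<dim_row A. \<Sum>j<dim_col A. (cmod (A $$ (i, j)))\<^sup>2)"

definition mat_exp :: "complex mat \<Rightarrow> complex mat" where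
  "mat_exp A = mat (dim_row A) (dim_row A) (\<lambda>ij. \<Sum>k. (A ^\<^sub>m k) $$ ij / fact k)"

definition mat_poly :: "complex poly \<Rightarrow> complex mat \<Rightarrow> complex mat" where
  "mat_poly q A = mat (dim_row A) (dim_row A)
     (\<lambda>ij. \<Sum>k\<le>degree q. coeff q k * (A ^\<^sub>m k) $$ ij)"

definition append_cols :: "complex mat \<Rightarrow> complex mat \<Rightarrow> complex mat" where
  "append_cols A B = four_block_mat A B (0\<^sub>m 0 (dim_col A)) (0\<^sub>m 0 (dim_col B))"

text \<open>The unitary polar factor \<open>U\<close> in \<open>A = U H\<close>; it is uniquely determined when \<open>A\<close> has full
  column rank, and is unspecified otherwise.\<close>

definition polar_factor :: "complex mat \<Rightarrow> complex mat" where
  "polar_factor A = (THE U. U \<in> carrier_mat (dim_row A) (dim_col A) \<and> orthonormal_cols U \<and>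
     (\<exists>H \<in> carrier_mat (dim_col A) (dim_col A). hermitian_posdef_mat H \<and> A = U * H))"

definition orth_complement :: "complex mat \<Rightarrow> complex mat \<Rightarrow> bool" where
  "orth_complement Y Yp \<longleftrightarrow>
     Yp \<in> carrier_mat (dim_row Y) (dim_row Y - dim_col Y) \<and> unitary_mat (append_cols Y Yp)"

text \<open>The set \<open>{Yp * K | K}\<close> is the same for every choice of \<open>Yp\<close>, so the union over all
  choices taken here is the tangent space.\<close>

definition tangent_Gr :: "complex mat \<Rightarrow> complex mat set" where
  "tangent_Gr Y = {Yp * K | Yp K.
     orth_complement Y Yp \<and> K \<in> carrier_mat (dim_row Y - dim_col Y) (dim_col Y)}"

definition exp_Gr_repr :: "complex mat \<Rightarrow> complex mat \<Rightarrow> complex mat \<Rightarrow> complex mat" where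
  "exp_Gr_repr Y Yp K = (let p = dim_col Y; q = dim_row Y - dim_col Y in
     append_cols Y Yp
     * mat_exp (four_block_mat (0\<^sub>m p p) (- mat_adjoint K) K (0\<^sub>m q q))
     * append_rows (1\<^sub>m p) (0\<^sub>m q p))"

text \<open>The value for a tangent vector \<open>H = Yp * K\<close>; it does not depend on which \<open>Yp\<close>
  (and hence \<open>K\<close>) is used to write \<open>H\<close>.\<close>

definition exp_Gr :: "complex mat \<Rightarrow> complex mat \<Rightarrow> complex mat" where
  "exp_Gr Y H = (THE E. \<exists>Yp K. orth_complement Y Yp \<and>
     K \<in> carrier_mat (dim_row Y - dim_col Y) (dim_col Y) \<and> H = Yp * K \<and>
     E = exp_Gr_repr Y Yp K)"

definition acoef :: "nat \<Rightarrow> nat \<Rightarrow> real" where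
  "acoef n k = real (n choose k) * fact (2 * n - k) / fact (2 * n) * 2 ^ k"

text \<open>Here \<open>[:0, -1:]\<close> is the polynomial \<open>-z\<close>.\<close>

definition alpha_poly :: "nat \<Rightarrow> complex poly" where
  "alpha_poly n = (\<Sum>j\<le>n div 2. smult (complex_of_real (acoef n (2 * j))) ([:0, -1:] ^ j))"

text \<open>The index range \<open>j < (n + 1) div 2\<close> is \<open>0 \<le> j \<le> \<lfloor>(n - 1) / 2\<rfloor>\<close>, read as empty for \<open>n = 0\<close>.\<close>

definition beta_poly :: "nat \<Rightarrow> complex poly" where
  "beta_poly n =
     (\<Sum>j<(n + 1) div 2. smult (complex_of_real (acoef n (2 * j + 1))) ([:0, -1:] ^ j))"

end

theory Submission
  imports Defs "Jordan_Normal_Form.Spectral_Radius" "HOL-Analysis.L2_Norm"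
begin

text \<open>Diagonalise \<open>H\<^sup>* H = Q diag(s\<^sub>l\<^sup>2) Q\<^sup>*\<close> and put \<open>x\<^sub>l = t s\<^sub>l\<close>. Summing the exponential series
  blockwise gives \<open>Exp(t H) = Y Q diag(cos x\<^sub>l) Q\<^sup>* + t H Q diag(sin x\<^sub>l / x\<^sub>l) Q\<^sup>*\<close>. The argument of
  the polar factor is \<open>Y Q diag(\<alpha>(x\<^sub>l\<^sup>2)) Q\<^sup>* + t H Q diag(\<beta>(x\<^sub>l\<^sup>2)) Q\<^sup>*\<close>; since the columns of \<open>Y Q\<close>
  and \<open>H Q\<close> are all mutually orthogonal, its polar factor is obtained by dividing column by column by
  \<open>r\<^sub>l = |\<Theta>(i x\<^sub>l)|\<close>, where \<open>\<Theta>(z) = \<Sum>\<^sub>k a\<^sub>k z\<^sup>k\<close> and \<open>\<Theta>(i x) = \<alpha>(x\<^sup>2) + i x \<beta>(x\<^sup>2)\<close>. So everything reduces to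
  comparing \<open>e\<^sup>i\<^sup>x\<close> with \<open>\<Theta>(i x) / |\<Theta>(i x)|\<close>, that is, to \<open>Im (e\<^sup>-\<^sup>i\<^sup>x \<Theta>(i x)) = O(x\<^sup>2\<^sup>n\<^sup>+\<^sup>1)\<close>. This is the
  Pade property of \<open>\<Theta>(z) / \<Theta>(-z)\<close> for \<open>e\<^sup>2\<^sup>z\<close>, and it follows by induction on \<open>n\<close> from
  \<open>\<Theta>\<^sub>n' - \<Theta>\<^sub>n = - z \<Theta>\<^sub>n\<^sub>-\<^sub>1 / (2 n - 1)\<close>.\<close>

section \<open>Spectral theorem for Hermitian matrices\<close>

lemma mat_adjoint_carrier [simp]: "A \<in> carrier_mat m n \<Longrightarrow> mat_adjoint A \<in> carrier_mat n m"
  unfolding mat_adjoint_def by (auto simp: mat_of_rows_def)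

lemma dim_mat_adjoint [simp]: "dim_row (mat_adjoint A) = dim_col A" "dim_col (mat_adjoint A) = dim_row A"
  unfolding mat_adjoint_def by (auto simp: mat_of_rows_def)

lemma index_mat_adjoint [simp]:
  fixes A :: "complex mat"
  assumes "i < dim_col A" "j < dim_row A"
  shows "mat_adjoint A $$ (i, j) = cnj (A $$ (j, i))"
  using assms unfolding mat_adjoint_def by (auto simp: mat_of_rows_def)

lemma mat_adjoint_adjoint [simp]:
  fixes A :: "complex mat"
  shows "mat_adjoint (mat_adjoint A) = A"
  by (rule eq_matI) auto

lemma mat_adjoint_mult:
  fixes A B :: "complex mat"
  assumes "A \<in> carrier_mat m n" "B \<in> carrier_mat n k"
  shows "mat_adjoint (A * B) = mat_adjoint B * mat_adjoint A"
  by (rule eq_matI) (use assms in \<open>auto simp: scalar_prod_def mult.commute\<close>)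

lemma mat_adjoint_add:
  fixes A B :: "complex mat"
  assumes "A \<in> carrier_mat m n" "B \<in> carrier_mat m n"
  shows "mat_adjoint (A + B) = mat_adjoint A + mat_adjoint B"
  by (rule eq_matI) (use assms in auto)

lemma mat_adjoint_minus:
  fixes A B :: "complex mat"
  assumes "A \<in> carrier_mat m n" "B \<in> carrier_mat m n"
  shows "mat_adjoint (A - B) = mat_adjoint A - mat_adjoint B"
  by (rule eq_matI) (use assms in auto)

lemma mat_adjoint_smult:
  fixes A :: "complex mat"
  shows "mat_adjoint (c \<cdot>\<^sub>m A) = cnj c \<cdot>\<^sub>m mat_adjoint A"
  by (rule eq_matI) auto

lemma mat_adjoint_one [simp]: "mat_adjoint (1\<^sub>m n :: complex mat) = 1\<^sub>m n"
  by (rule eq_matI) auto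

lemma mat_adjoint_zero [simp]: "mat_adjoint (0\<^sub>m m n :: complex mat) = 0\<^sub>m n m"
  by (rule eq_matI) auto

lemma mat_adjoint_four_block:
  fixes A :: "complex mat"
  assumes "A \<in> carrier_mat nr1 nc1" "B \<in> carrier_mat nr1 nc2"
    "C \<in> carrier_mat nr2 nc1" "D \<in> carrier_mat nr2 nc2"
  shows "mat_adjoint (four_block_mat A B C D) =
    four_block_mat (mat_adjoint A) (mat_adjoint C) (mat_adjoint B) (mat_adjoint D)"
  by (rule eq_matI) (use assms in auto)

lemma orthonormal_square_mat:
  fixes A :: "complex mat"
  assumes "A \<in> carrier_mat n n" "mat_adjoint A * A = 1\<^sub>m n"
  shows "A * mat_adjoint A = 1\<^sub>m n"
  using assms mat_mult_left_right_inverse[of "mat_adjoint A" n A] by auto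

text \<open>Complete \<open>v\<close> to a basis and orthogonalise by Gram-Schmidt, which leaves the
  first vector unchanged; dividing each vector by its length then gives the columns of
  \<open>W\<close>. This provides the change of basis for the deflation step of the spectral
  theorem.\<close>

lemma exists_unitary_first_col:
  fixes v :: "complex vec"
  assumes v: "v \<in> carrier_vec n" and v0: "v \<noteq> 0\<^sub>v n"
  shows "\<exists>W \<in> carrier_mat n n. mat_adjoint W * W = 1\<^sub>m n \<and> (\<exists>c. c \<noteq> 0 \<and> col W 0 = c \<cdot>\<^sub>v v)"
proof -
  have n: "n > 0"
    using v v0 by (cases n) auto
  interpret cof_vec_space n "TYPE(complex)" .
  define b where "b = basis_completion v"
  note bc = basis_completion[OF v v0, folded b_def]
  define ws where "ws = gram_schmidt n b"
  from gram_schmidt_result[OF bc(2) bc(4) bc(5) ws_def] bc(6)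
  have ws: "corthogonal ws" "set ws \<subseteq> carrier_vec n" "length ws = n" by auto
  have "b \<noteq> []"
    using bc(6) n by auto
  then have "b = v # tl b"
    using bc(7) by (metis list.collapse)
  then have "hd ws = v"
    using gram_schmidt_hd[OF v] unfolding ws_def by metis
  then have ws0: "ws ! 0 = v"
    using ws(3) n by (metis hd_conv_nth list.size(3) less_numeral_extra(3))
  have wsc: "ws ! i \<in> carrier_vec n" if "i < n" for i
    using ws that by auto
  define N where "N i = (\<Sum>k<n. (cmod (ws ! i $ k))\<^sup>2)" for i
  have sp: "(ws ! i \<bullet>c ws ! i) = complex_of_real (N i)" if "i < n" for i
    using wsc[OF that] unfolding N_def scalar_prod_def
    by (auto simp: complex_norm_square lessThan_atLeast0 simp del: of_real_power intro!: sum.cong)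
  have Nne: "N i \<noteq> 0" if "i < n" for i
    using sp[OF that] corthogonalD[OF ws(1), of i i] that ws(3) by auto
  then have Npos: "N i > 0" if "i < n" for i
    using that sum_nonneg[of "{..<n}" "\<lambda>k. (cmod (ws ! i $ k))\<^sup>2"] unfolding N_def
    by (metis less_eq_real_def zero_le_power2)
  define W where "W = mat n n (\<lambda>(i, j). ws ! j $ i / complex_of_real (sqrt (N j)))"
  have W: "W \<in> carrier_mat n n"
    unfolding W_def by auto
  have "mat_adjoint W * W = 1\<^sub>m n"
  proof (rule eq_matI)
    fix i j assume ij: "i < dim_row (1\<^sub>m n :: complex mat)" "j < dim_col (1\<^sub>m n :: complex mat)"
    then have i: "i < n" and j: "j < n" by auto
    have "(mat_adjoint W * W) $$ (i, j) = (ws ! j \<bullet>c ws ! i) / (complex_of_real (sqrt (N i)) * complex_of_real (sqrt (N j)))"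
      using i j W wsc[OF i] wsc[OF j]
      by (simp add: scalar_prod_def W_def sum_divide_distrib mult.commute)
    also have "\<dots> = 1\<^sub>m n $$ (i, j)"
    proof (cases "i = j")
      case True
      then show ?thesis
        using Npos[OF i] i sp[OF i] by (simp flip: of_real_mult)
    next
      case False
      then have "ws ! j \<bullet>c ws ! i = 0"
        using corthogonalD[OF ws(1), of j i] i j ws(3) by auto
      then show ?thesis
        using False i j by simp
    qed
    finally show "(mat_adjoint W * W) $$ (i, j) = 1\<^sub>m n $$ (i, j)" .
  qed (use W in auto)
  moreover have "col W 0 = (1 / complex_of_real (sqrt (N 0))) \<cdot>\<^sub>v v"
    using n v ws0 by (intro eq_vecI) (auto simp: W_def)
  moreover have "1 / complex_of_real (sqrt (N 0)) \<noteq> 0"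
    using Npos[OF n] by simp
  ultimately show ?thesis
    using W by blast
qed

text \<open>Functional calculus in a fixed basis: if \<open>Q\<close> is unitary and
  \<open>A = conj_diag Q d\<close>, then \<open>g(A)\<close> is
  \<open>conj_diag Q (\<lambda>l. g (d l))\<close>. The argument \<open>f\<close> depends on the
  index and not on the eigenvalue, so that expressions in the square roots \<open>s l\<close> of the
  eigenvalues fit as well.\<close>

definition conj_diag :: "complex mat \<Rightarrow> (nat \<Rightarrow> complex) \<Rightarrow> complex mat" where
  "conj_diag Q f = Q * mat_diag (dim_col Q) f * mat_adjoint Q"

text \<open>Deflation: an eigenvector, completed to a unitary \<open>W\<close>, makes
  \<open>W\<^sup>* A W\<close> block diagonal, with the eigenvalue in the corner and a smaller
  Hermitian block to which the induction hypothesis applies.\<close>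

theorem hermitian_spectral:
  assumes "A \<in> carrier_mat n n" "mat_adjoint A = A"
  shows "\<exists>Q \<in> carrier_mat n n. \<exists>d :: nat \<Rightarrow> real. mat_adjoint Q * Q = 1\<^sub>m n \<and>
    A = conj_diag Q (\<lambda>i. complex_of_real (d i))"
  using assms
proof (induction n arbitrary: A)
  case 0
  then show ?case
    by (intro bexI[of _ "1\<^sub>m 0"] exI) (auto simp: conj_diag_def)
next
  case (Suc n)
  note A = Suc.prems(1)
  let ?N = "Suc n"
  from spectrum_non_empty[OF A] obtain e where "eigenvalue A e"
    unfolding spectrum_def by auto
  then obtain v where v: "v \<in> carrier_vec ?N" "v \<noteq> 0\<^sub>v ?N" and Av: "A *\<^sub>v v = e \<cdot>\<^sub>v v"
    using A unfolding eigenvalue_def eigenvector_def by auto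
  from exists_unitary_first_col[OF v] obtain W c where W: "W \<in> carrier_mat ?N ?N"
    and WW: "mat_adjoint W * W = 1\<^sub>m ?N" and c: "col W 0 = c \<cdot>\<^sub>v v" by auto
  define B where "B = mat_adjoint W * (A * W)"
  have B: "B \<in> carrier_mat ?N ?N"
    using W A unfolding B_def by auto
  have Bherm: "mat_adjoint B = B"
    using W A Suc.prems(2) unfolding B_def
    by (simp add: mat_adjoint_mult[of _ ?N ?N _ ?N] assoc_mult_mat[of _ ?N ?N _ ?N _ ?N])
  have AW0: "col (A * W) 0 = e \<cdot>\<^sub>v col W 0"
    using v by (simp only: col_mult2[OF A W zero_less_Suc] c mult_mat_vec[OF A v(1)] Av
        smult_smult_assoc mult.commute)
  \<comment> \<open>The first column of \<open>W\<close> is an eigenvector and the columns of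
    \<open>W\<close> are orthonormal, so the first column of \<open>B\<close> is \<open>e\<close>
    times a unit vector. Hermitian symmetry then clears the first row and makes \<open>e\<close>
    real.\<close>
  have Bcol: "B $$ (i, 0) = e * (if i = 0 then 1 else 0)" if i: "i < ?N" for i
  proof -
    have "B $$ (i, 0) = row (mat_adjoint W) i \<bullet> col (A * W) 0"
      using i A W unfolding B_def by auto
    also have "\<dots> = e * (row (mat_adjoint W) i \<bullet> col W 0)"
      unfolding AW0 using W i by (auto)
    also have "row (mat_adjoint W) i \<bullet> col W 0 = (mat_adjoint W * W) $$ (i, 0)"
      using i W by auto
    finally show ?thesis
      unfolding WW using i by auto
  qed
  have Badj: "B $$ (i, j) = cnj (B $$ (j, i))" if "i < ?N" "j < ?N" for i j
    using that B index_mat_adjoint[of i B j] Bherm by auto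
  have Brow: "B $$ (0, j) = 0" if "j < ?N" "j \<noteq> 0" for j
    using Badj[of 0 j] Bcol[of j] that by auto
  have "cnj e = e"
    using Badj[of 0 0] Bcol[of 0] by auto
  then have e: "e = complex_of_real (Re e)"
    by (metis Reals_cnj_iff of_real_Re)
  define B' where "B' = mat n n (\<lambda>(i, j). B $$ (Suc i, Suc j))"
  have B': "B' \<in> carrier_mat n n"
    unfolding B'_def by auto
  have "mat_adjoint B' = B'"
    by (rule eq_matI) (auto simp: B'_def simp flip: Badj)
  from Suc.IH[OF B' this] obtain Q d where Q: "Q \<in> carrier_mat n n"
    and QQ: "mat_adjoint Q * Q = 1\<^sub>m n" and B'eq: "B' = conj_diag Q (\<lambda>i. complex_of_real (d i))"
    by blast
  \<comment> \<open>\<open>fb\<close> is the block-diagonal embedding with a corner of size 1;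
    products and adjoints act on its blocks separately.\<close>
  define fb where "fb X Y = four_block_mat X (0\<^sub>m 1 n) (0\<^sub>m n 1) Y" for X Y :: "complex mat"
  have fb_mult: "fb X Y * fb X' Y' = fb (X * X') (Y * Y')"
    if "X \<in> carrier_mat 1 1" "X' \<in> carrier_mat 1 1" "Y \<in> carrier_mat n n" "Y' \<in> carrier_mat n n" for X Y X' Y'
    unfolding fb_def using that by (subst mult_four_block_mat[of _ 1 1 _ n _ n]) auto
  have fb_adj: "mat_adjoint (fb X Y) = fb (mat_adjoint X) (mat_adjoint Y)"
    if "X \<in> carrier_mat 1 1" "Y \<in> carrier_mat n n" for X Y
    unfolding fb_def using that by (subst mat_adjoint_four_block[of _ 1 1 _ n _ n]) auto
  define D where "D i = (case i of 0 \<Rightarrow> Re e | Suc k \<Rightarrow> d k)" for i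
  define R where "R = fb (1\<^sub>m 1) Q"
  have R: "R \<in> carrier_mat ?N ?N"
    unfolding R_def fb_def using Q by auto
  have RR: "mat_adjoint R * R = 1\<^sub>m ?N"
    unfolding R_def using Q QQ
    by (subst fb_adj, simp, simp, subst fb_mult) (auto simp: fb_def)
  have dD: "mat_diag ?N (\<lambda>i. complex_of_real (D i)) = fb (mat 1 1 (\<lambda>_. e)) (mat_diag n (\<lambda>i. complex_of_real (d i)))"
    unfolding fb_def by (rule eq_matI) (auto simp: mat_diag_def D_def e[symmetric] split: nat.splits)
  have Beq: "B = fb (mat 1 1 (\<lambda>_. e)) B'"
    unfolding fb_def by (rule eq_matI) (use B in \<open>auto simp: B'_def Bcol Brow\<close>)
  also have "\<dots> = conj_diag R (\<lambda>i. complex_of_real (D i))"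
  proof -
    have "dim_col R = ?N" "dim_col Q = n"
      using R Q by auto
    then have "conj_diag R (\<lambda>i. complex_of_real (D i)) =
        R * fb (mat 1 1 (\<lambda>_. e)) (mat_diag n (\<lambda>i. complex_of_real (d i))) * mat_adjoint R"
      unfolding conj_diag_def by (simp only: dD)
    also have "\<dots> = fb (mat 1 1 (\<lambda>_. e)) (Q * mat_diag n (\<lambda>i. complex_of_real (d i)) * mat_adjoint Q)"
      unfolding R_def using Q by (simp add: fb_adj fb_mult)
    finally show ?thesis
      unfolding B'eq conj_diag_def using \<open>dim_col Q = n\<close> by simp
  qed
  finally have Bd: "B = conj_diag R (\<lambda>i. complex_of_real (D i))" .
  have WW': "W * mat_adjoint W = 1\<^sub>m ?N"
    using orthonormal_square_mat[OF W WW] .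
  have WmW: "W * (mat_adjoint W * X) = X" if "X \<in> carrier_mat ?N ?N" for X
    using that W WW' by (subst assoc_mult_mat[symmetric, of _ ?N ?N _ ?N _ ?N]) auto
  have WmW': "mat_adjoint W * (W * X) = X" if "X \<in> carrier_mat ?N ?N" for X
    using that W WW by (subst assoc_mult_mat[symmetric, of _ ?N ?N _ ?N _ ?N]) auto
  have "A = W * (B * mat_adjoint W)"
    unfolding B_def using A W WW'
    by (simp add: assoc_mult_mat[of _ ?N ?N _ ?N _ ?N] WmW)
  also have "\<dots> = conj_diag (W * R) (\<lambda>i. complex_of_real (D i))"
    unfolding Bd conj_diag_def using W R
    by (simp add: assoc_mult_mat[of _ ?N ?N _ ?N _ ?N] mult_carrier_mat[of _ ?N ?N _ ?N] mat_adjoint_mult[of _ ?N ?N _ ?N])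
  finally have "A = conj_diag (W * R) (\<lambda>i. complex_of_real (D i))" .
  moreover have "mat_adjoint (W * R) * (W * R) = 1\<^sub>m ?N"
    using W R RR by (simp add: assoc_mult_mat[of _ ?N ?N _ ?N _ ?N] mat_adjoint_mult[of _ ?N ?N _ ?N] WmW')
  moreover have "W * R \<in> carrier_mat ?N ?N"
    using W R by auto
  ultimately show ?case
    by blast
qed

section \<open>Functional calculus and the matrix exponential\<close>

lemma conj_diag_carrier [simp]: "Q \<in> carrier_mat n p \<Longrightarrow> conj_diag Q f \<in> carrier_mat n n"
  unfolding conj_diag_def by (auto intro!: mult_carrier_mat[of _ n p])

lemma dim_conj_diag [simp]: "dim_row (conj_diag Q f) = dim_row Q" "dim_col (conj_diag Q f) = dim_row Q"
  unfolding conj_diag_def by auto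

text \<open>The diagonal factor rescales the columns of \<open>Y * Q\<close>. In this form
  \<open>f\<close> enters linearly, one index at a time, so series and error bounds for matrices
  reduce to scalar ones.\<close>

lemma mult_conj_diag_index:
  assumes "Q \<in> carrier_mat p p" "Y \<in> carrier_mat m p" "i < m" "j < p"
  shows "(Y * conj_diag Q f) $$ (i, j) = (\<Sum>l<p. (Y * Q) $$ (i, l) * f l * cnj (Q $$ (j, l)))"
proof -
  have "Y * conj_diag Q f = (Y * Q) * mat_diag p f * mat_adjoint Q"
    unfolding conj_diag_def using assms
    by (simp add: assoc_mult_mat[of _ m p _ p _ p] assoc_mult_mat[of _ p p _ p _ p])
  also have "\<dots> = mat m p (\<lambda>(i, l). (Y * Q) $$ (i, l) * f l) * mat_adjoint Q"
    using assms by (subst mat_diag_mult_right[of _ m p]) auto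
  also have "\<dots> $$ (i, j) = (\<Sum>l<p. (Y * Q) $$ (i, l) * f l * cnj (Q $$ (j, l)))"
    using assms by (simp add: scalar_prod_def lessThan_atLeast0)
  finally show ?thesis .
qed

lemma conj_diag_index:
  assumes "Q \<in> carrier_mat p p" "i < p" "j < p"
  shows "conj_diag Q f $$ (i, j) = (\<Sum>l<p. Q $$ (i, l) * f l * cnj (Q $$ (j, l)))"
  using mult_conj_diag_index[of Q p "1\<^sub>m p" p i j f] assms by simp

lemma conj_diag_cong:
  assumes "Q \<in> carrier_mat p p" "\<And>l. l < p \<Longrightarrow> f l = g l"
  shows "conj_diag Q f = conj_diag Q g"
  by (rule eq_matI) (use assms in \<open>auto simp: conj_diag_index intro!: sum.cong\<close>)

lemma conj_diag_add:
  assumes "Q \<in> carrier_mat p p"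
  shows "conj_diag Q f + conj_diag Q g = conj_diag Q (\<lambda>l. f l + g l)"
  by (rule eq_matI) (use assms in \<open>auto simp: conj_diag_index distrib_left distrib_right sum.distrib\<close>)

lemma conj_diag_smult:
  assumes "Q \<in> carrier_mat p p"
  shows "c \<cdot>\<^sub>m conj_diag Q f = conj_diag Q (\<lambda>l. c * f l)"
  by (rule eq_matI) (use assms in \<open>auto simp: conj_diag_index sum_distrib_left algebra_simps\<close>)

lemma conj_diag_adjoint:
  assumes "Q \<in> carrier_mat p p"
  shows "mat_adjoint (conj_diag Q f) = conj_diag Q (\<lambda>l. cnj (f l))"
  by (rule eq_matI) (use assms in \<open>auto simp: conj_diag_index algebra_simps\<close>)

lemma conj_diag_mult:
  assumes Q: "Q \<in> carrier_mat p p" and QQ: "mat_adjoint Q * Q = 1\<^sub>m p"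
  shows "conj_diag Q f * conj_diag Q g = conj_diag Q (\<lambda>l. f l * g l)"
proof -
  have "mat_adjoint Q * (Q * X) = X" if "X \<in> carrier_mat p p" for X
    using that Q QQ by (subst assoc_mult_mat[symmetric, of _ p p _ p _ p]) auto
  moreover have "mat_diag p f * (mat_diag p g * X) = mat_diag p (\<lambda>l. f l * g l) * X"
    if "X \<in> carrier_mat p p" for X
    using that by (subst assoc_mult_mat[symmetric, of _ p p _ p _ p]) auto
  ultimately show ?thesis
    unfolding conj_diag_def using Q
    by (simp add: assoc_mult_mat[of _ p p _ p _ p] mult_carrier_mat[of _ p p _ p])
qed

lemma conj_diag_one:
  assumes "Q \<in> carrier_mat p p" "mat_adjoint Q * Q = 1\<^sub>m p"
  shows "conj_diag Q (\<lambda>_. 1) = 1\<^sub>m p"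
  using assms orthonormal_square_mat[OF assms] unfolding conj_diag_def by simp

lemma conj_diag_pow:
  assumes Q: "Q \<in> carrier_mat p p" and QQ: "mat_adjoint Q * Q = 1\<^sub>m p"
  shows "conj_diag Q f ^\<^sub>m k = conj_diag Q (\<lambda>l. f l ^ k)"
  using assms by (induction k) (auto simp: conj_diag_one conj_diag_mult mult.commute)

lemma mat_poly_conj_diag:
  assumes Q: "Q \<in> carrier_mat p p" and QQ: "mat_adjoint Q * Q = 1\<^sub>m p"
  shows "mat_poly q (conj_diag Q d) = conj_diag Q (\<lambda>l. poly q (d l))"
proof (rule eq_matI)
  fix i j assume "i < dim_row (conj_diag Q (\<lambda>l. poly q (d l)))" "j < dim_col (conj_diag Q (\<lambda>l. poly q (d l)))"
  then have ij: "i < p" "j < p"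
    using Q by auto
  have "mat_poly q (conj_diag Q d) $$ (i, j) = (\<Sum>k\<le>degree q. coeff q k * conj_diag Q (\<lambda>l. d l ^ k) $$ (i, j))"
    using ij Q unfolding mat_poly_def by (simp add: conj_diag_pow[OF Q QQ])
  also have "\<dots> = (\<Sum>l<p. \<Sum>k\<le>degree q. coeff q k * (Q $$ (i, l) * d l ^ k * cnj (Q $$ (j, l))))"
    using ij Q by (simp add: conj_diag_index sum_distrib_left sum.swap[of _ "{..<p}"])
  also have "\<dots> = conj_diag Q (\<lambda>l. poly q (d l)) $$ (i, j)"
    using ij Q by (simp add: conj_diag_index poly_altdef sum_distrib_left sum_distrib_right algebra_simps)
  finally show "mat_poly q (conj_diag Q d) $$ (i, j) = conj_diag Q (\<lambda>l. poly q (d l)) $$ (i, j)" .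
qed (use Q in \<open>auto simp: mat_poly_def\<close>)

text \<open>An entry of \<open>X ^\<^sub>m k\<close> is bounded by \<open>(N * c) ^ k\<close>, where
  \<open>c\<close> bounds every entry of \<open>X\<close>, so the exponential series of
  \<open>N * c\<close> is a majorant. Summability is what gives the entrywise infinite sum in
  \<open>mat_exp\<close> its meaning.\<close>

lemma mat_exp_sums:
  assumes X: "X \<in> carrier_mat N N" and ij: "i < N" "j < N"
  shows "(\<lambda>k. (X ^\<^sub>m k) $$ (i, j) / fact k) sums (mat_exp X $$ (i, j))"
proof -
  define c where "c = (\<Sum>a<N. \<Sum>b<N. cmod (X $$ (a, b)))"
  have cb: "cmod (X $$ (a, b)) \<le> c" if "a < N" "b < N" for a b
  proof -
    have "cmod (X $$ (a, b)) \<le> (\<Sum>b<N. cmod (X $$ (a, b)))"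
      using that by (intro member_le_sum) auto
    also have "\<dots> \<le> c"
      unfolding c_def using that
      by (intro member_le_sum[of a "{..<N}" "\<lambda>a. \<Sum>b<N. cmod (X $$ (a, b))"]) (auto intro: sum_nonneg)
    finally show ?thesis .
  qed
  have c0: "c \<ge> 0"
    unfolding c_def by (intro sum_nonneg) auto
  have bound: "cmod ((X ^\<^sub>m k) $$ (a, b)) \<le> (real N * c) ^ k" if "a < N" "b < N" for a b k
    using that
  proof (induction k arbitrary: b)
    case 0
    then show ?case using X by auto
  next
    case (Suc k)
    have "(X ^\<^sub>m Suc k) $$ (a, b) = (\<Sum>l<N. (X ^\<^sub>m k) $$ (a, l) * X $$ (l, b))"
      using Suc.prems X by (simp add: scalar_prod_def lessThan_atLeast0)
    also have "cmod \<dots> \<le> (\<Sum>l<N. (real N * c) ^ k * c)"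
      using Suc cb c0 by (intro sum_norm_le) (auto simp: norm_mult intro!: mult_mono)
    also have "\<dots> = (real N * c) ^ Suc k"
      by simp
    finally show ?case .
  qed
  have "summable (\<lambda>k. (real N * c) ^ k / fact k)"
    using summable_exp[of "real N * c"] by (simp add: divide_inverse mult.commute)
  then have "summable (\<lambda>k. (X ^\<^sub>m k) $$ (i, j) / fact k)"
    by (rule summable_comparison_test')
      (use bound ij in \<open>auto simp: norm_divide intro!: divide_right_mono\<close>)
  then show ?thesis
    using X ij unfolding mat_exp_def by (simp add: summable_sums)
qed

text \<open>An entry of \<open>L * Z * R\<close> is a finite linear combination of entries of
  \<open>Z\<close>, so the series may be summed after multiplication. The powers of the block matrix
  in the Riemannian exponential become simple only between these outer factors.\<close>

lemma mat_exp_sandwich_sums: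
  assumes L: "L \<in> carrier_mat m N" and X: "X \<in> carrier_mat N N" and R: "R \<in> carrier_mat N p"
    and ij: "i < m" "j < p"
  shows "(\<lambda>k. (L * X ^\<^sub>m k * R) $$ (i, j) / fact k) sums ((L * mat_exp X * R) $$ (i, j))"
proof -
  have idx: "(L * Z * R) $$ (i, j) = (\<Sum>a<N. L $$ (i, a) * (\<Sum>b<N. Z $$ (a, b) * R $$ (b, j)))"
    if "Z \<in> carrier_mat N N" for Z
    using that L R ij by (simp add: scalar_prod_def lessThan_atLeast0)
  have E: "mat_exp X \<in> carrier_mat N N"
    using X unfolding mat_exp_def by auto
  have "(\<lambda>k. \<Sum>a<N. L $$ (i, a) * (\<Sum>b<N. (X ^\<^sub>m k) $$ (a, b) / fact k * R $$ (b, j)))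
      sums (\<Sum>a<N. L $$ (i, a) * (\<Sum>b<N. mat_exp X $$ (a, b) * R $$ (b, j)))"
    using mat_exp_sums[OF X] by (intro sums_sum sums_mult2 sums_mult) auto
  then show ?thesis
    using X E by (simp add: idx sum_divide_distrib sum_distrib_left)
qed

section \<open>The Riemannian exponential\<close>

lemma append_cols_carrier:
  assumes "A \<in> carrier_mat m p" "B \<in> carrier_mat m q"
  shows "append_cols A B \<in> carrier_mat m (p + q)"
  using four_block_carrier_mat[OF assms(1), of "0\<^sub>m 0 (dim_col B)" 0 q] assms
  unfolding append_cols_def by auto

text \<open>Compare the blocks of \<open>C\<^sup>* C = 1\<close> for the unitary matrix
  \<open>C\<close> with column blocks \<open>Y\<close> and \<open>Yp\<close>.\<close>

lemma orth_complement_D: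
  assumes Y: "Y \<in> carrier_mat m p" and pm: "p \<le> m" and oc: "orth_complement Y Yp"
  shows "Yp \<in> carrier_mat m (m - p)" "mat_adjoint Y * Yp = 0\<^sub>m p (m - p)"
    "mat_adjoint Yp * Yp = 1\<^sub>m (m - p)"
proof -
  show Yp: "Yp \<in> carrier_mat m (m - p)"
    using oc Y unfolding orth_complement_def by auto
  let ?C = "append_cols Y Yp"
  have C: "?C \<in> carrier_mat m m"
    using append_cols_carrier[OF Y Yp] pm by simp
  have Ci: "?C $$ (k, i) = (if i < p then Y $$ (k, i) else Yp $$ (k, i - p))" if "k < m" "i < m" for k i
    using that Y Yp pm unfolding append_cols_def by auto
  have CC: "mat_adjoint ?C * ?C = 1\<^sub>m m"
    using oc C unfolding orth_complement_def unitary_mat_def by auto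
  have ent: "(\<Sum>k<m. cnj (?C $$ (k, i)) * ?C $$ (k, j)) = (if i = j then 1 else 0)"
    if "i < m" "j < m" for i j
  proof -
    have "(mat_adjoint ?C * ?C) $$ (i, j) = (\<Sum>k<m. cnj (?C $$ (k, i)) * ?C $$ (k, j))"
      using that C by (simp add: scalar_prod_def lessThan_atLeast0)
    then show ?thesis
      unfolding CC using that by simp
  qed
  show "mat_adjoint Y * Yp = 0\<^sub>m p (m - p)"
  proof (rule eq_matI)
    fix i j assume "i < dim_row (0\<^sub>m p (m - p) :: complex mat)" "j < dim_col (0\<^sub>m p (m - p) :: complex mat)"
    then have ij: "i < p" "j < m - p" by auto
    then show "(mat_adjoint Y * Yp) $$ (i, j) = 0\<^sub>m p (m - p) $$ (i, j)"
      using ent[of i "p + j"] Y Yp pm by (simp add: scalar_prod_def lessThan_atLeast0 Ci)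
  qed (use Y Yp in auto)
  show "mat_adjoint Yp * Yp = 1\<^sub>m (m - p)"
  proof (rule eq_matI)
    fix i j assume "i < dim_row (1\<^sub>m (m - p) :: complex mat)" "j < dim_col (1\<^sub>m (m - p) :: complex mat)"
    then have ij: "i < m - p" "j < m - p" by auto
    then show "(mat_adjoint Yp * Yp) $$ (i, j) = 1\<^sub>m (m - p) $$ (i, j)"
      using ent[of "p + i" "p + j"] Y Yp pm by (simp add: scalar_prod_def lessThan_atLeast0 Ci)
  qed (use Yp in auto)
qed

lemma tangent_Gr_D:
  assumes Y: "Y \<in> carrier_mat m p" and pm: "p \<le> m" and H: "H \<in> tangent_Gr Y"
  shows "H \<in> carrier_mat m p" "mat_adjoint Y * H = 0\<^sub>m p p"
proof -
  from H Y obtain Yp K where oc: "orth_complement Y Yp" and K: "K \<in> carrier_mat (m - p) p"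
    and HK: "H = Yp * K"
    unfolding tangent_Gr_def by auto
  note D = orth_complement_D[OF Y pm oc]
  show "H \<in> carrier_mat m p"
    using D(1) K HK by auto
  have "mat_adjoint Y * H = mat_adjoint Y * Yp * K"
    unfolding HK using Y D(1) K by (simp add: assoc_mult_mat[of _ p m _ "m - p" _ p])
  then show "mat_adjoint Y * H = 0\<^sub>m p p"
    unfolding D(2) using K by simp
qed

lemma tangent_Gr_smult:
  assumes Y: "Y \<in> carrier_mat m p" and H: "H \<in> tangent_Gr Y"
  shows "c \<cdot>\<^sub>m H \<in> tangent_Gr Y"
proof -
  from H Y obtain Yp K where oc: "orth_complement Y Yp" and K: "K \<in> carrier_mat (m - p) p"
    and HK: "H = Yp * K"
    unfolding tangent_Gr_def by auto
  have "Yp \<in> carrier_mat m (m - p)"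
    using oc Y unfolding orth_complement_def by auto
  then have "c \<cdot>\<^sub>m H = Yp * (c \<cdot>\<^sub>m K)"
    unfolding HK using K by (simp add: mult_smult_distrib[of _ m "m - p" _ p])
  then show ?thesis
    using oc K Y unfolding tangent_Gr_def by (intro CollectI exI[of _ Yp] exI[of _ "c \<cdot>\<^sub>m K"]) auto
qed

lemma pow_mat_mult_commute:
  fixes A :: "complex mat"
  assumes "A \<in> carrier_mat n n"
  shows "A ^\<^sub>m Suc k = A * A ^\<^sub>m k"
  using assms by (induction k) (auto simp: assoc_mult_mat[of _ n n _ n _ n])

text \<open>\<open>Z\<close> sends a column with blocks \<open>U\<close>, \<open>V\<close> to the
  one with blocks \<open>- K\<^sup>* V\<close>, \<open>K U\<close>. Starting from
  \<open>V = 0\<close>, the nonzero block alternates between top and bottom, and every second step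
  multiplies it by \<open>- K\<^sup>* K\<close>.\<close>

lemma exp_Gr_block_pow:
  fixes K :: "complex mat"
  assumes K: "K \<in> carrier_mat q p"
  defines "Z \<equiv> four_block_mat (0\<^sub>m p p) (- mat_adjoint K) K (0\<^sub>m q q)"
    and "N \<equiv> - (mat_adjoint K * K)"
  shows "Z ^\<^sub>m k * append_rows (1\<^sub>m p) (0\<^sub>m q p) =
    (if even k then append_rows (N ^\<^sub>m (k div 2)) (0\<^sub>m q p)
     else append_rows (0\<^sub>m p p) (K * N ^\<^sub>m (k div 2)))"
proof (induction k)
  case 0
  show ?case
    using K unfolding Z_def N_def by (simp add: append_rows_def)
next
  case (Suc k)
  have Z: "Z \<in> carrier_mat (p + q) (p + q)"
    unfolding Z_def using K by auto
  have N: "N \<in> carrier_mat p p"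
    unfolding N_def using K by auto
  have ZUV: "Z * append_rows U V = append_rows (- mat_adjoint K * V) (K * U)"
    if "U \<in> carrier_mat p p" "V \<in> carrier_mat q p" for U V
    unfolding Z_def append_rows_def using that K
    by (subst mult_four_block_mat[of _ p p _ q _ q _ _ p _ 0]) (auto intro!: cong_four_block_mat eq_matI)
  have E: "append_rows (1\<^sub>m p) (0\<^sub>m q p :: complex mat) \<in> carrier_mat (p + q) p"
    by auto
  have "Z ^\<^sub>m Suc k * append_rows (1\<^sub>m p) (0\<^sub>m q p) = Z * (Z ^\<^sub>m k * append_rows (1\<^sub>m p) (0\<^sub>m q p))"
    unfolding pow_mat_mult_commute[OF Z] using Z E
    by (intro assoc_mult_mat[of _ "p + q" "p + q" _ "p + q" _ p]) auto
  also have "\<dots> = (if even (Suc k) then append_rows (N ^\<^sub>m (Suc k div 2)) (0\<^sub>m q p)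
     else append_rows (0\<^sub>m p p) (K * N ^\<^sub>m (Suc k div 2)))"
  proof (cases "even k")
    case True
    have "- mat_adjoint K * 0\<^sub>m q p = (0\<^sub>m p p :: complex mat)"
      using K by auto
    then show ?thesis
      unfolding Suc.IH using True N by (simp add: ZUV)
  next
    case False
    have "- mat_adjoint K * (K * N ^\<^sub>m (k div 2)) = N * N ^\<^sub>m (k div 2)"
      unfolding N_def using K N N_def
      by (simp add: assoc_mult_mat[of _ p q _ p _ p])
    also have "\<dots> = N ^\<^sub>m (Suc k div 2)"
      using False pow_mat_mult_commute[OF N, of "k div 2"] by simp
    finally show ?thesis
      unfolding Suc.IH using False N K by (simp add: ZUV)
  qed
  finally show ?case .
qed

lemma append_cols_mult_append_rows:
  fixes A :: "complex mat"
  assumes "A \<in> carrier_mat m p" "B \<in> carrier_mat m q" "U \<in> carrier_mat p r" "V \<in> carrier_mat q r"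
  shows "append_cols A B * append_rows U V = A * U + B * V"
proof -
  have "append_cols A B * append_rows U V =
      four_block_mat (A * U + B * V) (A * 0\<^sub>m p 0 + B * 0\<^sub>m q 0)
        (0\<^sub>m 0 p * U + 0\<^sub>m 0 q * V) (0\<^sub>m 0 p * 0\<^sub>m p 0 + 0\<^sub>m 0 q * 0\<^sub>m q 0)"
    unfolding append_cols_def append_rows_def using assms
    by (subst mult_four_block_mat[of _ m p _ q _ 0 _ _ r _ 0]) auto
  also have "\<dots> = A * U + B * V"
    by (rule eq_matI) (use assms in auto)
  finally show ?thesis .
qed

text \<open>The cosine series, indexed by all \<open>k\<close> with zeros at odd positions, so that
  it can be added term by term to the odd series below and matched with the powers of the block
  matrix.\<close>

lemma cos_even_sums:
  "(\<lambda>k. (if even k then (- ((s::real)\<^sup>2)) ^ (k div 2) else 0) / fact k) sums cos s"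
proof -
  have "(if even k then (- (s\<^sup>2)) ^ (k div 2) else 0) / fact k = cos_coeff k *\<^sub>R s ^ k" for k
    unfolding cos_coeff_def by (auto simp: power_minus[of "s\<^sup>2"] power_mult[symmetric] elim!: evenE)
  then show ?thesis
    using cos_converges[of s] by presburger
qed

text \<open>The continuous extension of \<open>sin s / s\<close>; the value at 0 is needed for zero
  eigenvalues of \<open>H\<^sup>* H\<close> and for \<open>t = 0\<close>.\<close>

definition sinc :: "real \<Rightarrow> real" where
  "sinc s = (if s = 0 then 1 else sin s / s)"

lemma mult_sinc [simp]: "s * sinc s = sin s"
  by (simp add: sinc_def)

text \<open>For nonzero \<open>s\<close> this is the sine series divided by \<open>s\<close>. For
  \<open>s = 0\<close> only the term \<open>k = 1\<close> survives, where the power is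
  \<open>0 ^ 0 = 1\<close>.\<close>

lemma sinc_odd_sums:
  "(\<lambda>k. (if even k then 0 else (- (s\<^sup>2)) ^ (k div 2)) / fact k) sums sinc s"
proof (cases "s = 0")
  case True
  have "(\<lambda>k. (if even k then 0 else (- (s\<^sup>2)) ^ (k div 2)) / fact k) = (\<lambda>k. if k = 1 then 1 else 0 :: real)"
  proof
    fix k :: nat
    show "(if even k then 0 else (- (s\<^sup>2)) ^ (k div 2)) / fact k = (if k = 1 then 1 else 0 :: real)"
      using True by (cases "k div 2 = 0") (auto simp: power_0_left elim!: oddE)
  qed
  then show ?thesis
    using sums_single[of 1 "\<lambda>_. 1 :: real"] True by (simp add: sinc_def)
next
  case False
  have "(if even k then 0 else (- (s\<^sup>2)) ^ (k div 2)) / fact k = sin_coeff k *\<^sub>R s ^ k / s" for k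
    unfolding sin_coeff_def using False
    by (auto simp: power_minus[of "s\<^sup>2"] power_mult[symmetric] elim!: oddE)
  then show ?thesis
    using sums_divide[OF sin_converges[of s], of s] False unfolding sinc_def by presburger
qed

text \<open>With \<open>- K\<^sup>* K\<close> diagonalised by \<open>Q\<close>, the even powers of
  the block matrix sum to a cosine on the \<open>Y\<close> side and the odd powers to a
  \<open>sinc\<close> on the \<open>Yp * K\<close> side.\<close>

lemma exp_Gr_repr_eq:
  assumes Y: "Y \<in> carrier_mat m p" and pm: "p \<le> m"
    and oc: "orth_complement Y Yp" and K: "K \<in> carrier_mat (m - p) p"
    and Q: "Q \<in> carrier_mat p p" and QQ: "mat_adjoint Q * Q = 1\<^sub>m p"
    and HH: "mat_adjoint (Yp * K) * (Yp * K) = conj_diag Q (\<lambda>l. complex_of_real ((s l)\<^sup>2))"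
  shows "exp_Gr_repr Y Yp K =
    Y * conj_diag Q (\<lambda>l. complex_of_real (cos (s l))) + Yp * K * conj_diag Q (\<lambda>l. complex_of_real (sinc (s l)))"
proof -
  define q where "q = m - p"
  note oD = orth_complement_D[OF Y pm oc, folded q_def]
  have pq: "p + q = m"
    using pm q_def by simp
  have K': "K \<in> carrier_mat q p"
    using K q_def by simp
  define Z where "Z = four_block_mat (0\<^sub>m p p) (- mat_adjoint K) K (0\<^sub>m q q)"
  define E where "E = append_rows (1\<^sub>m p) (0\<^sub>m q p :: complex mat)"
  define C where "C = append_cols Y Yp"
  define H where "H = Yp * K"
  have H: "H \<in> carrier_mat m p"
    unfolding H_def using oD(1) K' by auto
  have Z: "Z \<in> carrier_mat m m"
    unfolding Z_def using four_block_carrier_mat[of "0\<^sub>m p p" p p "0\<^sub>m q q" q q] pq by simp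
  have E: "E \<in> carrier_mat m p"
    unfolding E_def using carrier_append_rows[of "1\<^sub>m p" p p "0\<^sub>m q p" q] pq by simp
  have C: "C \<in> carrier_mat m m"
    unfolding C_def using append_cols_carrier[OF Y oD(1)] pq by simp
  \<comment> \<open>Inserting \<open>Yp\<^sup>* Yp = 1\<close> replaces \<open>K\<^sup>* K\<close>
    by \<open>H\<^sup>* H\<close>, for which a diagonalisation is given.\<close>
  have "mat_adjoint K * K = mat_adjoint K * (mat_adjoint Yp * Yp * K)"
    unfolding oD(3) using K' by simp
  also have "\<dots> = mat_adjoint H * H"
    unfolding H_def using K' oD(1)
    by (simp add: mat_adjoint_mult[of _ m q _ p] assoc_mult_mat[of _ q m _ q _ p] assoc_mult_mat[of _ p q _ m _ p])
  finally have "mat_adjoint K * K = mat_adjoint H * H" .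
  then have "- (mat_adjoint K * K) = (-1) \<cdot>\<^sub>m conj_diag Q (\<lambda>l. complex_of_real ((s l)\<^sup>2))"
    unfolding H_def HH by (intro eq_matI) auto
  also have "\<dots> = conj_diag Q (\<lambda>l. complex_of_real (- ((s l)\<^sup>2)))"
    unfolding conj_diag_smult[OF Q] by simp
  finally have N: "- (mat_adjoint K * K) = conj_diag Q (\<lambda>l. complex_of_real (- ((s l)\<^sup>2)))" .
  \<comment> \<open>\<open>f k\<close> and \<open>g k\<close> are the diagonal contributions of the
    \<open>k\<close>-th power on the \<open>Y\<close> side and on the \<open>H\<close> side; one of
    them vanishes according to parity, so a single formula covers both cases.\<close>
  define f where "f k l = (if even k then (- ((s l)\<^sup>2)) ^ (k div 2) else 0)" for k l :: nat
  define g where "g k l = (if even k then 0 else (- ((s l)\<^sup>2)) ^ (k div 2))" for k l :: nat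
  have zero: "conj_diag Q (\<lambda>l. 0) = 0\<^sub>m p p"
    by (rule eq_matI) (use Q in \<open>auto simp: conj_diag_index\<close>)
  have CZE: "C * Z ^\<^sub>m k * E = Y * conj_diag Q (\<lambda>l. complex_of_real (f k l)) + H * conj_diag Q (\<lambda>l. complex_of_real (g k l))" for k
  proof -
    have "C * Z ^\<^sub>m k * E = C * (Z ^\<^sub>m k * E)"
      using C Z E by (intro assoc_mult_mat[of _ m m _ m _ p]) auto
    also have "Z ^\<^sub>m k * E = (if even k then append_rows (conj_diag Q (\<lambda>l. complex_of_real (- ((s l)\<^sup>2))) ^\<^sub>m (k div 2)) (0\<^sub>m q p)
     else append_rows (0\<^sub>m p p) (K * conj_diag Q (\<lambda>l. complex_of_real (- ((s l)\<^sup>2))) ^\<^sub>m (k div 2)))"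
      using exp_Gr_block_pow[OF K', of k] unfolding Z_def E_def N .
    also have "C * \<dots> = Y * conj_diag Q (\<lambda>l. complex_of_real (f k l)) + H * conj_diag Q (\<lambda>l. complex_of_real (g k l))"
    proof (cases "even k")
      case True
      have "C * append_rows (conj_diag Q (\<lambda>l. complex_of_real ((- ((s l)\<^sup>2)) ^ (k div 2)))) (0\<^sub>m q p)
          = Y * conj_diag Q (\<lambda>l. complex_of_real ((- ((s l)\<^sup>2)) ^ (k div 2))) + Yp * 0\<^sub>m q p"
        unfolding C_def using Y oD(1) Q by (intro append_cols_mult_append_rows) auto
      also have "Yp * 0\<^sub>m q p = H * 0\<^sub>m p p"
        using oD(1) H by simp
      finally show ?thesis
        using True zero by (simp add: conj_diag_pow[OF Q QQ] f_def g_def)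
    next
      case False
      have "C * append_rows (0\<^sub>m p p) (K * conj_diag Q (\<lambda>l. complex_of_real ((- ((s l)\<^sup>2)) ^ (k div 2))))
          = Y * 0\<^sub>m p p + Yp * (K * conj_diag Q (\<lambda>l. complex_of_real ((- ((s l)\<^sup>2)) ^ (k div 2))))"
        unfolding C_def using Y oD(1) Q K' by (intro append_cols_mult_append_rows) auto
      also have "Yp * (K * conj_diag Q (\<lambda>l. complex_of_real ((- ((s l)\<^sup>2)) ^ (k div 2))))
          = H * conj_diag Q (\<lambda>l. complex_of_real ((- ((s l)\<^sup>2)) ^ (k div 2)))"
        unfolding H_def using oD(1) K' Q by (simp add: assoc_mult_mat[of _ m q _ p _ p])
      finally show ?thesis
        using False zero by (simp add: conj_diag_pow[OF Q QQ] f_def g_def)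
    qed
    finally show ?thesis .
  qed
  have repr: "exp_Gr_repr Y Yp K = C * mat_exp Z * E"
    unfolding exp_Gr_repr_def C_def Z_def E_def q_def using Y by (simp add: Let_def)
  show ?thesis
    unfolding repr H_def[symmetric]
  proof (rule eq_matI)
    fix i j
    assume "i < dim_row (Y * conj_diag Q (\<lambda>l. complex_of_real (cos (s l))) + H * conj_diag Q (\<lambda>l. complex_of_real (sinc (s l))))"
      "j < dim_col (Y * conj_diag Q (\<lambda>l. complex_of_real (cos (s l))) + H * conj_diag Q (\<lambda>l. complex_of_real (sinc (s l))))"
    then have ij: "i < m" "j < p"
      using H Q by auto
    have lin: "(Y * conj_diag Q F + H * conj_diag Q G) $$ (i, j) =
        (\<Sum>l<p. (Y * Q) $$ (i, l) * F l * cnj (Q $$ (j, l))) + (\<Sum>l<p. (H * Q) $$ (i, l) * G l * cnj (Q $$ (j, l)))"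
      for F G
      using ij H Q Y by (simp add: mult_conj_diag_index[OF Q Y ij] mult_conj_diag_index[OF Q H ij] del: index_mult_mat(1))
    have "(\<lambda>k. (\<Sum>l<p. (Y * Q) $$ (i, l) * complex_of_real (f k l / fact k) * cnj (Q $$ (j, l)))
        + (\<Sum>l<p. (H * Q) $$ (i, l) * complex_of_real (g k l / fact k) * cnj (Q $$ (j, l)))) sums
      ((\<Sum>l<p. (Y * Q) $$ (i, l) * complex_of_real (cos (s l)) * cnj (Q $$ (j, l)))
        + (\<Sum>l<p. (H * Q) $$ (i, l) * complex_of_real (sinc (s l)) * cnj (Q $$ (j, l))))"
      unfolding f_def g_def
      by (intro sums_add sums_sum sums_mult sums_mult2 sums_of_real cos_even_sums sinc_odd_sums)
    moreover have "(\<Sum>l<p. (Y * Q) $$ (i, l) * complex_of_real (f k l / fact k) * cnj (Q $$ (j, l)))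
        + (\<Sum>l<p. (H * Q) $$ (i, l) * complex_of_real (g k l / fact k) * cnj (Q $$ (j, l)))
        = (C * Z ^\<^sub>m k * E) $$ (i, j) / fact k" for k
      unfolding CZE lin by (simp add: sum_divide_distrib add_divide_distrib del: index_mult_mat(1))
    ultimately have "(\<lambda>k. (C * Z ^\<^sub>m k * E) $$ (i, j) / fact k) sums
        (Y * conj_diag Q (\<lambda>l. complex_of_real (cos (s l))) + H * conj_diag Q (\<lambda>l. complex_of_real (sinc (s l)))) $$ (i, j)"
      unfolding lin by (simp only:)
    then show "(C * mat_exp Z * E) $$ (i, j) =
        (Y * conj_diag Q (\<lambda>l. complex_of_real (cos (s l))) + H * conj_diag Q (\<lambda>l. complex_of_real (sinc (s l)))) $$ (i, j)"
      using mat_exp_sandwich_sums[OF C Z E ij] sums_unique2 by blast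
  qed (use C E H Q in auto)
qed

text \<open>The formula for a representation contains \<open>Yp\<close> and \<open>K\<close> only
  through their product \<open>H\<close>, hence all representations agree and the definite
  description is well defined. The signs of \<open>s l\<close> are free, since only squares occur in
  the hypothesis.\<close>

lemma exp_Gr_eq:
  assumes Y: "Y \<in> carrier_mat m p" and pm: "p \<le> m" and H: "H \<in> tangent_Gr Y"
    and Q: "Q \<in> carrier_mat p p" and QQ: "mat_adjoint Q * Q = 1\<^sub>m p"
    and HH: "mat_adjoint H * H = conj_diag Q (\<lambda>l. complex_of_real ((s l)\<^sup>2))"
  shows "exp_Gr Y H =
    Y * conj_diag Q (\<lambda>l. complex_of_real (cos (s l))) + H * conj_diag Q (\<lambda>l. complex_of_real (sinc (s l)))"
proof -
  have dims: "dim_row Y = m" "dim_col Y = p"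
    using Y by auto
  have eq: "exp_Gr_repr Y Yp K =
    Y * conj_diag Q (\<lambda>l. complex_of_real (cos (s l))) + H * conj_diag Q (\<lambda>l. complex_of_real (sinc (s l)))"
    if "orth_complement Y Yp" "K \<in> carrier_mat (m - p) p" "H = Yp * K" for Yp K
    using exp_Gr_repr_eq[OF Y pm that(1,2) Q QQ] HH that(3) by simp
  from H obtain Yp K where "orth_complement Y Yp" "K \<in> carrier_mat (m - p) p" "H = Yp * K"
    unfolding tangent_Gr_def dims by auto
  then show ?thesis
    unfolding exp_Gr_def dims by (intro the_equality) (metis eq)+
qed

section \<open>Polar factors\<close>

lemma mat_adjoint_scalar_prod:
  fixes A :: "complex mat"
  assumes A: "A \<in> carrier_mat m n" and x: "x \<in> carrier_vec m" and y: "y \<in> carrier_vec n"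
  shows "(mat_adjoint A *\<^sub>v x) \<bullet>c y = x \<bullet>c (A *\<^sub>v y)"
proof -
  have "(mat_adjoint A *\<^sub>v x) \<bullet>c y = (\<Sum>j<n. \<Sum>i<m. cnj (A $$ (i, j)) * x $ i * cnj (y $ j))"
    using A x y by (simp add: scalar_prod_def lessThan_atLeast0 sum_distrib_right)
  also have "\<dots> = (\<Sum>i<m. \<Sum>j<n. cnj (A $$ (i, j)) * x $ i * cnj (y $ j))"
    by (rule sum.swap)
  also have "\<dots> = x \<bullet>c (A *\<^sub>v y)"
    using A x y by (simp add: scalar_prod_def lessThan_atLeast0 sum_distrib_left mult_ac)
  finally show ?thesis .
qed

lemma Re_scalar_prod_self_pos:
  fixes v :: "complex vec"
  assumes "v \<in> carrier_vec n" "v \<noteq> 0\<^sub>v n"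
  shows "Re (v \<bullet>c v) > 0"
  using conjugate_square_greater_0_vec[OF assms(1)] assms(2) by (simp add: less_complex_def)

text \<open>The matrix is \<open>S * S\<close> with \<open>S\<close> Hermitian, so its quadratic
  form at \<open>v\<close> is the squared length of \<open>S v\<close>. The matrix \<open>T\<close>
  of reciprocal roots inverts \<open>S\<close>, so \<open>S v\<close> is nonzero.\<close>

lemma hermitian_posdef_conj_diag:
  assumes Q: "Q \<in> carrier_mat p p" and QQ: "mat_adjoint Q * Q = 1\<^sub>m p"
    and d: "\<And>l. l < p \<Longrightarrow> d l > (0 :: real)"
  shows "hermitian_posdef_mat (conj_diag Q (\<lambda>l. complex_of_real (d l)))"
proof -
  let ?S = "conj_diag Q (\<lambda>l. complex_of_real (sqrt (d l)))"
  let ?T = "conj_diag Q (\<lambda>l. complex_of_real (1 / sqrt (d l)))"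
  have S: "?S \<in> carrier_mat p p" and T: "?T \<in> carrier_mat p p"
    using Q by simp_all
  have zero: "X *\<^sub>v 0\<^sub>v p = 0\<^sub>v p" if "X \<in> carrier_mat p p" for X :: "complex mat"
    using that by (intro eq_vecI) auto
  have Sadj: "mat_adjoint ?S = ?S"
    by (simp add: conj_diag_adjoint[OF Q])
  have SS: "conj_diag Q (\<lambda>l. complex_of_real (d l)) = ?S * ?S"
    unfolding conj_diag_mult[OF Q QQ] using d
    by (intro conj_diag_cong[OF Q]) (simp add: less_imp_le flip: of_real_mult)
  have "?T * ?S = conj_diag Q (\<lambda>_. 1)"
    unfolding conj_diag_mult[OF Q QQ] using d
    by (intro conj_diag_cong[OF Q]) (simp flip: of_real_mult add: less_imp_neq[THEN not_sym])
  then have TS: "?T * ?S = 1\<^sub>m p"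
    by (simp add: conj_diag_one[OF Q QQ])
  have "Re ((conj_diag Q (\<lambda>l. complex_of_real (d l)) *\<^sub>v v) \<bullet>c v) > 0"
    if v: "v \<in> carrier_vec p" "v \<noteq> 0\<^sub>v p" for v
  proof -
    have Sv: "?S *\<^sub>v v \<in> carrier_vec p"
      using S v by simp
    have "?S *\<^sub>v v \<noteq> 0\<^sub>v p"
    proof
      assume "?S *\<^sub>v v = 0\<^sub>v p"
      then have "(?T * ?S) *\<^sub>v v = ?T *\<^sub>v 0\<^sub>v p"
        using S T v by (simp add: assoc_mult_mat_vec[of _ p p _ p])
      also have "\<dots> = 0\<^sub>v p"
        using T by (rule zero)
      finally show False
        using v unfolding TS by simp
    qed
    then have "Re ((?S *\<^sub>v v) \<bullet>c (?S *\<^sub>v v)) > 0"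
      using Re_scalar_prod_self_pos[OF Sv] by simp
    also have "(?S *\<^sub>v v) \<bullet>c (?S *\<^sub>v v) = (?S *\<^sub>v (?S *\<^sub>v v)) \<bullet>c v"
      using mat_adjoint_scalar_prod[OF S Sv v(1)] unfolding Sadj by simp
    also have "?S *\<^sub>v (?S *\<^sub>v v) = (?S * ?S) *\<^sub>v v"
      using S v by (simp add: assoc_mult_mat_vec[of _ p p _ p])
    finally show ?thesis
      unfolding SS .
  qed
  then show ?thesis
    unfolding hermitian_posdef_mat_def hermitian_mat_def using Q
    by (simp add: conj_diag_adjoint[OF Q])
qed

lemma adjoint_conj_diag_entry:
  fixes R P :: "complex mat"
  assumes R: "R \<in> carrier_mat p p" and P: "P \<in> carrier_mat p p" and l: "l < p"
  shows "(mat_adjoint R * (P * R)) $$ (l, l) = (P *\<^sub>v col R l) \<bullet>c col R l"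
proof -
  have "(mat_adjoint R * (P * R)) $$ (l, l) = row (mat_adjoint R) l \<bullet> (P *\<^sub>v col R l)"
    unfolding col_mult2[OF P R l, symmetric] using R P l by (intro index_mult_mat(1)) auto
  also have "row (mat_adjoint R) l = conjugate (col R l)"
    using R l by (intro eq_vecI) auto
  also have "conjugate (col R l) \<bullet> (P *\<^sub>v col R l) = (P *\<^sub>v col R l) \<bullet>c col R l"
    using R P l by (intro comm_scalar_prod[of _ p]) auto
  finally show ?thesis .
qed

text \<open>The diagonal entry is the quadratic form of \<open>P\<close> at column \<open>l\<close>
  of \<open>R\<close>, which is nonzero because \<open>R\<^sup>* R = 1\<close>.\<close>

lemma posdef_diag_entry_pos:
  assumes R: "R \<in> carrier_mat p p" and RR: "mat_adjoint R * R = 1\<^sub>m p"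
    and P: "P \<in> carrier_mat p p" and pd: "hermitian_posdef_mat P" and l: "l < p"
  shows "Re ((mat_adjoint R * (P * R)) $$ (l, l)) > 0"
proof -
  have "col R l \<noteq> 0\<^sub>v p"
  proof
    assume "col R l = 0\<^sub>v p"
    then have "(mat_adjoint R * R) $$ (l, l) = 0"
      using R l by (simp add: scalar_prod_def)
    then show False
      unfolding RR using l by simp
  qed
  moreover have "col R l \<in> carrier_vec p"
    using R l by auto
  ultimately show ?thesis
    unfolding adjoint_conj_diag_entry[OF R P l] using pd P unfolding hermitian_posdef_mat_def by auto
qed

lemma posdef_spectral:
  assumes P: "P \<in> carrier_mat p p" and pd: "hermitian_posdef_mat P"
  obtains R d where "R \<in> carrier_mat p p" "mat_adjoint R * R = 1\<^sub>m p"
    "\<And>l. l < p \<Longrightarrow> d l > (0 :: real)" "P = conj_diag R (\<lambda>l. complex_of_real (d l))"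
proof -
  have "mat_adjoint P = P"
    using pd unfolding hermitian_posdef_mat_def hermitian_mat_def by auto
  from hermitian_spectral[OF P this] obtain R d where R: "R \<in> carrier_mat p p"
    and RR: "mat_adjoint R * R = 1\<^sub>m p" and Pd: "P = conj_diag R (\<lambda>l. complex_of_real (d l))"
    by blast
  have "d l > 0" if l: "l < p" for l
  proof -
    have X: "mat_adjoint R * (R * X) = X" if "X \<in> carrier_mat p p" for X
      using that R RR by (subst assoc_mult_mat[symmetric, of _ p p _ p _ p]) auto
    have "mat_adjoint R * (P * R) = mat_diag p (\<lambda>l. complex_of_real (d l))"
      unfolding Pd conj_diag_def using R RR
      by (simp add: assoc_mult_mat[of _ p p _ p _ p] mult_carrier_mat[of _ p p _ p] right_mult_one_mat[of _ p p] X)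
    then show ?thesis
      using posdef_diag_entry_pos[OF R RR P pd l] l by (simp add: mat_diag_def)
  qed
  then show ?thesis
    using that R RR Pd by blast
qed

text \<open>The difference \<open>D = P1 - P2\<close> solves the Sylvester equation
  \<open>P1 D + D P2 = 0\<close>. In an eigenbasis of \<open>D\<close> its diagonal entries read
  \<open>d l * (A l l + B l l) = 0\<close>, where both diagonal entries in the bracket have positive
  real part, so every eigenvalue of \<open>D\<close> is zero.\<close>

lemma posdef_square_root_unique:
  assumes P1: "P1 \<in> carrier_mat p p" "hermitian_posdef_mat P1"
    and P2: "P2 \<in> carrier_mat p p" "hermitian_posdef_mat P2"
    and eq: "P1 * P1 = P2 * P2"
  shows "P1 = P2"
proof -
  define D where "D = P1 - P2"
  have D: "D \<in> carrier_mat p p"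
    unfolding D_def using P1 P2 by auto
  have "mat_adjoint D = D"
    unfolding D_def using P1 P2
    by (simp add: mat_adjoint_minus[of _ p p] hermitian_posdef_mat_def hermitian_mat_def)
  from hermitian_spectral[OF D this] obtain R d where R: "R \<in> carrier_mat p p"
    and RR: "mat_adjoint R * R = 1\<^sub>m p" and Dd: "D = conj_diag R (\<lambda>l. complex_of_real (d l))"
    by blast
  define M where "M = mat_diag p (\<lambda>l. complex_of_real (d l))"
  have M: "M \<in> carrier_mat p p"
    unfolding M_def by simp
  have D': "D = R * M * mat_adjoint R"
    unfolding Dd conj_diag_def M_def using R by simp
  have X: "mat_adjoint R * (R * X) = X" if "X \<in> carrier_mat p p" for X
    using that R RR by (subst assoc_mult_mat[symmetric, of _ p p _ p _ p]) auto
  have DR: "D * R = R * M"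
    unfolding D' using R M RR by (simp add: assoc_mult_mat[of _ p p _ p _ p] mult_carrier_mat[of _ p p _ p])
  have RD: "mat_adjoint R * (D * X) = M * (mat_adjoint R * X)" if "X \<in> carrier_mat p p" for X
    unfolding D' using R M that by (simp add: assoc_mult_mat[of _ p p _ p _ p] mult_carrier_mat[of _ p p _ p] X)
  \<comment> \<open>The mixed products cancel without any commutation of \<open>P1\<close> and
    \<open>P2\<close>.\<close>
  have "P1 * D + D * P2 = (P1 * P1 - P1 * P2) + (P1 * P2 - P2 * P2)"
    unfolding D_def using P1(1) P2(1)
    by (simp add: mult_minus_distrib_mat[of _ p p _ p] minus_mult_distrib_mat[of _ p p _ _ p])
  also have "\<dots> = 0\<^sub>m p p"
    unfolding eq using P1(1) P2(1) by (intro eq_matI) auto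
  finally have sylv: "P1 * D + D * P2 = 0\<^sub>m p p" .
  have "d l = 0" if l: "l < p" for l
  proof -
    let ?A = "mat_adjoint R * (P1 * R)" and ?B = "mat_adjoint R * (P2 * R)"
    have AB: "?A \<in> carrier_mat p p" "?B \<in> carrier_mat p p"
      using R P1(1) P2(1) by auto
    have "?A * M + M * ?B = mat_adjoint R * (P1 * (D * R)) + mat_adjoint R * (D * (P2 * R))"
      using R M P1(1) P2(1)
      by (simp add: DR RD assoc_mult_mat[of _ p p _ p _ p] mult_carrier_mat[of _ p p _ p])
    also have "\<dots> = mat_adjoint R * ((P1 * D + D * P2) * R)"
      using R D P1(1) P2(1)
      by (simp add: assoc_mult_mat[of _ p p _ p _ p] mult_carrier_mat[of _ p p _ p]
          mult_add_distrib_mat[of _ p p _ p] add_mult_distrib_mat[of _ p p _ _ p])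
    also have "\<dots> = 0\<^sub>m p p"
      unfolding sylv using R by simp
    finally have "(?A * M + M * ?B) $$ (l, l) = 0"
      using l by simp
    moreover have "(?A * M + M * ?B) $$ (l, l) = (?A * M) $$ (l, l) + (M * ?B) $$ (l, l)"
      using l M AB by (intro index_add_mat(1)) auto
    moreover have "(?A * M) $$ (l, l) = ?A $$ (l, l) * complex_of_real (d l)"
      unfolding M_def mat_diag_mult_right[OF AB(1)] using l by simp
    moreover have "(M * ?B) $$ (l, l) = complex_of_real (d l) * ?B $$ (l, l)"
      unfolding M_def mat_diag_mult_left[OF AB(2)] using l by simp
    ultimately have "complex_of_real (d l) * (?A $$ (l, l) + ?B $$ (l, l)) = 0"
      by (simp add: distrib_left mult.commute)
    moreover have "Re (?A $$ (l, l) + ?B $$ (l, l)) > 0"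
      using posdef_diag_entry_pos[OF R RR P1 l] posdef_diag_entry_pos[OF R RR P2 l] by simp
    ultimately show "d l = 0"
      by (metis less_irrefl mult_eq_0_iff of_real_eq_0_iff zero_complex.sel(1))
  qed
  then have "D = conj_diag R (\<lambda>_. 0)"
    unfolding Dd by (intro conj_diag_cong[OF R]) simp
  also have "\<dots> = 0\<^sub>m p p"
    by (rule eq_matI) (use R in \<open>auto simp: conj_diag_index\<close>)
  finally have D0: "P1 - P2 = 0\<^sub>m p p"
    unfolding D_def .
  show ?thesis
  proof (rule eq_matI)
    fix i j assume "i < dim_row P2" "j < dim_col P2"
    then show "P1 $$ (i, j) = P2 $$ (i, j)"
      using arg_cong[OF D0, of "\<lambda>M. M $$ (i, j)"] P1(1) P2(1) by simp
  qed (use P1(1) P2(1) in auto)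
qed

lemma polar_square:
  fixes U P :: "complex mat"
  assumes U: "U \<in> carrier_mat m p" "orthonormal_cols U"
    and P: "P \<in> carrier_mat p p" "hermitian_posdef_mat P"
  shows "mat_adjoint (U * P) * (U * P) = P * P"
proof -
  have "mat_adjoint P = P"
    using P(2) unfolding hermitian_posdef_mat_def hermitian_mat_def by auto
  then have "mat_adjoint (U * P) * (U * P) = P * (mat_adjoint U * U * P)"
    using U(1) P(1)
    by (simp add: mat_adjoint_mult[of _ m p _ p] assoc_mult_mat[of _ p p _ m _ p] assoc_mult_mat[of _ p m _ p _ p])
  then show ?thesis
    using U P unfolding orthonormal_cols_def by simp
qed

text \<open>In any polar decomposition the positive factor squares to the Gram matrix of the
  product, so it is the unique positive definite square root of that matrix. It is invertible, which
  then determines \<open>U\<close> as well.\<close>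

lemma polar_factor_eq:
  fixes U P :: "complex mat"
  assumes U: "U \<in> carrier_mat m p" "orthonormal_cols U"
    and P: "P \<in> carrier_mat p p" "hermitian_posdef_mat P"
  shows "polar_factor (U * P) = U"
proof -
  have uniq: "U' = U"
    if U': "U' \<in> carrier_mat m p" "orthonormal_cols U'"
      and P': "P' \<in> carrier_mat p p" "hermitian_posdef_mat P'" and eq: "U * P = U' * P'" for U' P'
  proof -
    have "P' * P' = P * P"
      using polar_square[OF U P] polar_square[OF U' P'] eq by simp
    then have P'P: "P' = P"
      using posdef_square_root_unique[OF P' P] by simp
    from posdef_spectral[OF P] obtain R d where R: "R \<in> carrier_mat p p" "mat_adjoint R * R = 1\<^sub>m p"
      and d: "\<And>l. l < p \<Longrightarrow> d l > (0 :: real)" and Pd: "P = conj_diag R (\<lambda>l. complex_of_real (d l))"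
      by blast
    \<comment> \<open>The inverse of \<open>P\<close>, built from the reciprocals of its positive
      eigenvalues.\<close>
    let ?I = "conj_diag R (\<lambda>l. complex_of_real (1 / d l))"
    have I: "?I \<in> carrier_mat p p"
      using R by simp
    have "P * ?I = conj_diag R (\<lambda>_. 1)"
      unfolding Pd conj_diag_mult[OF R] using d
      by (intro conj_diag_cong[OF R(1)]) (simp flip: of_real_mult add: less_imp_neq[THEN not_sym])
    then have PI: "P * ?I = 1\<^sub>m p"
      by (simp add: conj_diag_one[OF R])
    have "V = V * P * ?I" if "V \<in> carrier_mat m p" for V
      using that P(1) I PI by (simp add: assoc_mult_mat[of _ m p _ p _ p])
    then show "U' = U"
      using U(1) U'(1) eq unfolding P'P by metis
  qed
  have "dim_row (U * P) = m" "dim_col (U * P) = p"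
    using U P by auto
  then show ?thesis
    unfolding polar_factor_def using U P uniq
    by (intro the_equality) auto
qed

text \<open>The cross terms vanish because \<open>Y\<^sup>* H = 0\<close>. What remains is
  \<open>F F + G (H\<^sup>* H) G\<close> with \<open>F\<close> and \<open>G\<close> Hermitian, and
  all factors are diagonal in the basis \<open>Q\<close>.\<close>

lemma gram_conj_diag:
  assumes Y: "Y \<in> carrier_mat m p" and YY: "mat_adjoint Y * Y = 1\<^sub>m p"
    and H: "H \<in> carrier_mat m p" and YH: "mat_adjoint Y * H = 0\<^sub>m p p"
    and Q: "Q \<in> carrier_mat p p" and QQ: "mat_adjoint Q * Q = 1\<^sub>m p"
    and HH: "mat_adjoint H * H = conj_diag Q (\<lambda>l. complex_of_real ((s l)\<^sup>2))"
  shows "mat_adjoint (Y * conj_diag Q (\<lambda>l. complex_of_real (f l)) + H * conj_diag Q (\<lambda>l. complex_of_real (g l)))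
     * (Y * conj_diag Q (\<lambda>l. complex_of_real (f l)) + H * conj_diag Q (\<lambda>l. complex_of_real (g l)))
   = conj_diag Q (\<lambda>l. complex_of_real ((f l)\<^sup>2 + (s l)\<^sup>2 * (g l)\<^sup>2))"
proof -
  define F where "F = conj_diag Q (\<lambda>l. complex_of_real (f l))"
  define G where "G = conj_diag Q (\<lambda>l. complex_of_real (g l))"
  have FG: "F \<in> carrier_mat p p" "G \<in> carrier_mat p p"
    unfolding F_def G_def using Q by simp_all
  have adj: "mat_adjoint F = F" "mat_adjoint G = G"
    unfolding F_def G_def by (simp_all add: conj_diag_adjoint[OF Q])
  have HY: "mat_adjoint H * Y = 0\<^sub>m p p"
    using arg_cong[OF YH, of mat_adjoint] Y H by (simp add: mat_adjoint_mult[of _ p m _ p])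
  have left: "mat_adjoint Y * (Y * X) = X" "mat_adjoint Y * (H * X) = 0\<^sub>m p p"
    "mat_adjoint H * (Y * X) = 0\<^sub>m p p" "mat_adjoint H * (H * X) = mat_adjoint H * H * X"
    if "X \<in> carrier_mat p p" for X
    using that Y H YY YH HY by (simp_all add: assoc_mult_mat[symmetric, of _ p m _ p _ p] del: assoc_mult_mat)
  have "mat_adjoint (Y * F + H * G) = F * mat_adjoint Y + G * mat_adjoint H"
    using Y H FG adj by (simp add: mat_adjoint_add[of _ m p] mat_adjoint_mult[of _ m p _ p])
  then have "mat_adjoint (Y * F + H * G) * (Y * F + H * G)
      = F * (mat_adjoint Y * (Y * F + H * G)) + G * (mat_adjoint H * (Y * F + H * G))"
    using Y H FG
    by (simp add: add_mult_distrib_mat[of _ p m _ _ p] assoc_mult_mat[of _ p p _ m _ p])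
  also have "mat_adjoint Y * (Y * F + H * G) = F"
    using Y H FG by (simp add: mult_add_distrib_mat[of _ p m _ p] left)
  also have "mat_adjoint H * (Y * F + H * G) = conj_diag Q (\<lambda>l. complex_of_real ((s l)\<^sup>2)) * G"
    using Y H FG Q by (simp add: mult_add_distrib_mat[of _ p m _ p] left HH
        left_add_zero_mat[of _ p p] mult_carrier_mat[of _ p p _ p])
  also have "F * F + G * (conj_diag Q (\<lambda>l. complex_of_real ((s l)\<^sup>2)) * G)
      = conj_diag Q (\<lambda>l. complex_of_real ((f l)\<^sup>2 + (s l)\<^sup>2 * (g l)\<^sup>2))"
    unfolding F_def G_def conj_diag_mult[OF Q QQ] conj_diag_add[OF Q]
    by (intro conj_diag_cong[OF Q]) (simp add: power2_eq_square)
  finally show ?thesis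
    unfolding F_def G_def .
qed

text \<open>The squares \<open>(r l)\<^sup>2\<close> are the eigenvalues of the Gram matrix of the
  argument, so \<open>conj_diag Q r\<close> is its positive factor and dividing by
  \<open>r l\<close> restores orthonormality. Full rank of the argument is expressed by
  \<open>r l > 0\<close>.\<close>

lemma polar_factor_conj_diag:
  assumes Y: "Y \<in> carrier_mat m p" and YY: "mat_adjoint Y * Y = 1\<^sub>m p"
    and H: "H \<in> carrier_mat m p" and YH: "mat_adjoint Y * H = 0\<^sub>m p p"
    and Q: "Q \<in> carrier_mat p p" and QQ: "mat_adjoint Q * Q = 1\<^sub>m p"
    and HH: "mat_adjoint H * H = conj_diag Q (\<lambda>l. complex_of_real ((s l)\<^sup>2))"
    and r: "\<And>l. l < p \<Longrightarrow> r l > 0 \<and> (r l)\<^sup>2 = (f l)\<^sup>2 + (s l)\<^sup>2 * (g l)\<^sup>2"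
  shows "polar_factor (Y * conj_diag Q (\<lambda>l. complex_of_real (f l)) + H * conj_diag Q (\<lambda>l. complex_of_real (g l)))
    = Y * conj_diag Q (\<lambda>l. complex_of_real (f l / r l)) + H * conj_diag Q (\<lambda>l. complex_of_real (g l / r l))"
    (is "polar_factor ?A = ?U")
proof -
  let ?P = "conj_diag Q (\<lambda>l. complex_of_real (r l))"
  have P: "?P \<in> carrier_mat p p"
    using Q by simp
  have U: "?U \<in> carrier_mat m p"
    using Y H Q by auto
  have "mat_adjoint ?U * ?U = conj_diag Q (\<lambda>_. 1)"
    unfolding gram_conj_diag[OF Y YY H YH Q QQ HH]
  proof (intro conj_diag_cong[OF Q])
    fix l assume "l < p"
    with r have *: "r l > 0" "(r l)\<^sup>2 = (f l)\<^sup>2 + (s l)\<^sup>2 * (g l)\<^sup>2" by auto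
    have "(f l / r l)\<^sup>2 + (s l)\<^sup>2 * (g l / r l)\<^sup>2 = ((f l)\<^sup>2 + (s l)\<^sup>2 * (g l)\<^sup>2) / (r l)\<^sup>2"
      by (simp add: power_divide add_divide_distrib)
    also have "\<dots> = 1"
      unfolding *(2)[symmetric] using *(1) by simp
    finally show "complex_of_real ((f l / r l)\<^sup>2 + (s l)\<^sup>2 * (g l / r l)\<^sup>2) = 1"
      by simp
  qed
  then have "orthonormal_cols ?U"
    unfolding orthonormal_cols_def using U Q by (simp add: conj_diag_one[OF Q QQ])
  moreover have "hermitian_posdef_mat ?P"
    using r by (intro hermitian_posdef_conj_diag[OF Q QQ]) auto
  moreover have "?A = ?U * ?P"
  proof -
    have rr: "conj_diag Q (\<lambda>l. complex_of_real (h l / r l)) * ?P = conj_diag Q (\<lambda>l. complex_of_real (h l))" for h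
      unfolding conj_diag_mult[OF Q QQ]
    proof (intro conj_diag_cong[OF Q])
      fix l assume "l < p"
      then have "r l \<noteq> 0"
        using r by fastforce
      then show "complex_of_real (h l / r l) * complex_of_real (r l) = complex_of_real (h l)"
        by simp
    qed
    show ?thesis
      using Y H Q P by (simp add: add_mult_distrib_mat[of _ m p _ _ p] assoc_mult_mat[of _ m p _ p _ p] rr
        del: of_real_divide)
  qed
  ultimately show ?thesis
    using polar_factor_eq[OF U _ P] by simp
qed

text \<open>The Euclidean norm of the entries is at most their sum norm; this turns entrywise error
  bounds into a bound for the Frobenius norm.\<close>

lemma frob_norm_le_sum:
  "frob_norm A \<le> (\<Sum>i<dim_row A. \<Sum>j<dim_col A. cmod (A $$ (i, j)))"
proof -
  have "frob_norm A = L2_set (\<lambda>(i, j). cmod (A $$ (i, j))) ({..<dim_row A} \<times> {..<dim_col A})"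
    unfolding frob_norm_def L2_set_def sum.cartesian_product by (simp add: case_prod_unfold)
  also have "\<dots> \<le> (\<Sum>(i, j)\<in>{..<dim_row A} \<times> {..<dim_col A}. cmod (A $$ (i, j)))"
    by (rule L2_set_le_sum) auto
  finally show ?thesis
    unfolding sum.cartesian_product .
qed

section \<open>Diagonal Pade approximation of the exponential\<close>

lemma acoef_0 [simp]: "acoef n 0 = 1"
  by (simp add: acoef_def)

lemma acoef_eq_0: "n < k \<Longrightarrow> acoef n k = 0"
  by (simp add: acoef_def)

text \<open>This is the coefficient of \<open>z ^ Suc j\<close> in the identity for
  \<open>\<Theta>\<^sub>n' - \<Theta>\<^sub>n\<close> with \<open>n = Suc N\<close>. Once the
  factorials are expressed by \<open>F\<close> and \<open>G\<close>, only Pascal's rule and the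
  absorption identity for binomial coefficients are needed.\<close>

lemma acoef_Suc_Suc:
  assumes "j \<le> N"
  shows "real (Suc (Suc j)) * acoef (Suc N) (Suc (Suc j)) - acoef (Suc N) (Suc j)
    = - acoef N j / (2 * real N + 1)"
proof -
  define c b1 b2 where "c = real (Suc N choose Suc j)" and "b1 = real (N choose j)"
    and "b2 = real (N choose Suc j)"
  define F where "F = (fact (2 * N - j) :: real)"
  define G where "G = (fact (2 * N) :: real)"
  have c1: "(real j + 2) * real (Suc N choose Suc (Suc j)) = (real N + 1) * b2"
    unfolding b2_def using arg_cong[OF Suc_times_binomial[of "Suc j" N], of real]
    by (simp add: algebra_simps del: binomial_Suc_Suc)
  have c2: "(real j + 1) * c = (real N + 1) * b1"
    unfolding b1_def c_def using Suc_times_binomial[of j N]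
    by (metis add.commute of_nat_Suc of_nat_mult)
  have c3: "c = b1 + b2"
    unfolding c_def b1_def b2_def by simp
  have f1: "(fact (2 * Suc N - Suc j) :: real) = (2 * real N + 1 - real j) * F"
  proof -
    have "2 * Suc N - Suc j = Suc (2 * N - j)"
      using assms by simp
    then show ?thesis
      using assms unfolding F_def by (simp add: of_nat_diff)
  qed
  have f2: "(fact (2 * Suc N) :: real) = (2 * real N + 2) * (2 * real N + 1) * G"
    unfolding G_def by (simp add: algebra_simps)
  have f3: "(fact (2 * Suc N - Suc (Suc j)) :: real) = F"
    unfolding F_def by simp
  have G: "G > 0"
    unfolding G_def by simp
  have "real (Suc (Suc j)) * acoef (Suc N) (Suc (Suc j)) - acoef (Suc N) (Suc j)
    = ((real j + 2) * real (Suc N choose Suc (Suc j)) * 4 - 2 * c * (2 * real N + 1 - real j)) * F * 2 ^ j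
      / ((2 * real N + 2) * (2 * real N + 1) * G)"
    unfolding acoef_def f1 f2 f3 c_def by (simp add: diff_divide_distrib add_divide_distrib left_diff_distrib algebra_simps del: binomial_Suc_Suc)
  \<comment> \<open>Split \<open>2 N + 1 - j\<close> as \<open>(2 N + 2) - (j + 1)\<close>.
    Absorption turns \<open>(j + 1) c\<close> into \<open>(N + 1) b1\<close>, and Pascal's rule
    \<open>c = b1 + b2\<close> cancels \<open>b2\<close>.\<close>
  also have "(real j + 2) * real (Suc N choose Suc (Suc j)) * 4 - 2 * c * (2 * real N + 1 - real j)
     = - (2 * real N + 2) * b1"
    unfolding c1 using c2 unfolding c3 by (simp add: algebra_simps)
  also have "- (2 * real N + 2) * b1 * F * 2 ^ j / ((2 * real N + 2) * (2 * real N + 1) * G)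
     = - acoef N j / (2 * real N + 1)"
    unfolding acoef_def b1_def F_def[symmetric] G_def[symmetric] using G
    by (simp add: divide_simps) (simp add: algebra_simps)
  finally show ?thesis .
qed

text \<open>The polynomial \<Theta> of the overview: the reverse Bessel polynomial, scaled to have
  constant term 1.\<close>

definition pade_num :: "nat \<Rightarrow> complex \<Rightarrow> complex" where
  "pade_num n z = (\<Sum>k\<le>n. complex_of_real (acoef n k) * z ^ k)"

text \<open>The term \<open>k = n\<close> is zero because \<open>acoef n (Suc n) = 0\<close>;
  including it gives the same index range as \<open>pade_num\<close>, so the two can be subtracted
  term by term.\<close>

definition pade_num_deriv :: "nat \<Rightarrow> complex \<Rightarrow> complex" where
  "pade_num_deriv n z = (\<Sum>k\<le>n. complex_of_real (real (Suc k) * acoef n (Suc k)) * z ^ k)"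

lemma pade_num_has_derivative: "(pade_num n has_field_derivative pade_num_deriv n z) (at z)"
proof -
  have "((\<lambda>z. \<Sum>k\<le>n. complex_of_real (acoef n k) * z ^ k) has_field_derivative
      (\<Sum>k\<le>n. complex_of_real (acoef n k) * (of_nat k * z ^ (k - 1)))) (at z)"
    by (auto intro!: derivative_eq_intros sum.cong)
  moreover have "(\<Sum>k\<le>n. complex_of_real (acoef n k) * (of_nat k * z ^ (k - 1))) = pade_num_deriv n z"
  proof -
    have "(\<Sum>k\<le>n. complex_of_real (acoef n k) * (of_nat k * z ^ (k - 1)))
        = (\<Sum>k\<le>Suc n. complex_of_real (acoef n k) * (of_nat k * z ^ (k - 1)))"
      by (simp add: acoef_eq_0)
    also have "\<dots> = (\<Sum>k\<le>n. complex_of_real (acoef n (Suc k)) * (of_nat (Suc k) * z ^ k))"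
      by (subst sum.atMost_Suc_shift) simp
    finally show ?thesis
      unfolding pade_num_deriv_def by (simp add: mult_ac)
  qed
  ultimately show ?thesis
    unfolding pade_num_def[abs_def] by simp
qed

text \<open>The constant terms cancel because the coefficients of index 0 and 1 are both 1; the
  remaining coefficients are given by \<open>acoef_Suc_Suc\<close>.\<close>

lemma pade_num_deriv_Suc:
  "pade_num_deriv (Suc N) z - pade_num (Suc N) z = - (z / (2 * of_nat N + 1)) * pade_num N z"
proof -
  have "pade_num_deriv (Suc N) z - pade_num (Suc N) z
      = (\<Sum>k\<le>Suc N. complex_of_real (real (Suc k) * acoef (Suc N) (Suc k) - acoef (Suc N) k) * z ^ k)"
    unfolding pade_num_deriv_def pade_num_def sum_subtractf[symmetric]
    by (intro sum.cong) (simp_all add: left_diff_distrib)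
  also have "\<dots> = complex_of_real (acoef (Suc N) 1 - acoef (Suc N) 0)
      + (\<Sum>k\<le>N. complex_of_real (real (Suc (Suc k)) * acoef (Suc N) (Suc (Suc k)) - acoef (Suc N) (Suc k)) * z ^ Suc k)"
    by (subst sum.atMost_Suc_shift) simp
  also have "acoef (Suc N) 1 - acoef (Suc N) 0 = 0"
    by (simp add: acoef_def divide_simps)
  also have "(\<Sum>k\<le>N. complex_of_real (real (Suc (Suc k)) * acoef (Suc N) (Suc (Suc k)) - acoef (Suc N) (Suc k)) * z ^ Suc k)
      = (\<Sum>k\<le>N. complex_of_real (- acoef N k / (2 * real N + 1)) * z ^ Suc k)"
    by (intro sum.cong refl) (simp only: acoef_Suc_Suc atMost_iff)
  also have "\<dots> = - (z / (2 * of_nat N + 1)) * pade_num N z"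
    unfolding pade_num_def by (simp add: sum_distrib_left sum_divide_distrib sum_negf mult_ac)
  finally show ?thesis
    by simp
qed

text \<open>It would be real and positive if the phase of \<open>\<Theta>(i x)\<close> were exactly
  \<open>x\<close>, so its imaginary part measures the phase error.\<close>

definition pade_defect :: "nat \<Rightarrow> real \<Rightarrow> complex" where
  "pade_defect n x = exp (- \<i> * complex_of_real x) * pade_num n (\<i> * complex_of_real x)"

text \<open>Differentiating the exponential factor produces \<open>\<Theta>' - \<Theta>\<close>. The
  two factors \<open>\<i>\<close> then combine to a real multiplier, so the imaginary parts satisfy
  the same recursion.\<close>

lemma pade_defect_Suc_has_derivative:
  "(pade_defect (Suc N) has_vector_derivative
     complex_of_real (x / (2 * real N + 1)) * pade_defect N x) (at x)"
proof -
  let ?g = "\<lambda>z. exp (- \<i> * z) * pade_num (Suc N) (\<i> * z)"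
  let ?z = "complex_of_real x"
  have "((\<lambda>z. pade_num (Suc N) (\<i> * z)) has_field_derivative pade_num_deriv (Suc N) (\<i> * ?z) * \<i>) (at ?z)"
    by (rule DERIV_chain2[OF pade_num_has_derivative]) (auto intro!: derivative_eq_intros)
  then have "(?g has_field_derivative
      \<i> * exp (- \<i> * ?z) * (pade_num_deriv (Suc N) (\<i> * ?z) - pade_num (Suc N) (\<i> * ?z))) (at ?z)"
    by (auto intro!: derivative_eq_intros simp: algebra_simps)
  also have "\<i> * exp (- \<i> * ?z) * (pade_num_deriv (Suc N) (\<i> * ?z) - pade_num (Suc N) (\<i> * ?z))
      = complex_of_real (x / (2 * real N + 1)) * pade_defect N x"
    unfolding pade_num_deriv_Suc pade_defect_def
    by (simp add: mult_ac)
  finally show ?thesis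
    unfolding pade_defect_def[abs_def] by (rule has_vector_derivative_real_field)
qed

text \<open>Each induction step gains two powers of \<open>x\<close>: one from the factor
  \<open>x\<close> in the derivative and one from the mean value theorem, since the defect is real
  at 0. The constant stays 1 because \<open>1 / (2 N + 1) \<le> 1\<close>.\<close>

lemma abs_Im_pade_defect_le: "\<bar>Im (pade_defect n x)\<bar> \<le> \<bar>x\<bar> ^ (2 * n + 1)"
proof (induction n arbitrary: x)
  case 0
  have "Im (pade_defect 0 x) = - sin x"
    by (simp add: pade_defect_def pade_num_def Im_exp)
  then show ?case
    by (simp add: abs_sin_x_le_abs_x)
next
  case (Suc N)
  let ?f = "\<lambda>x. Im (pade_defect (Suc N) x)"
  have d: "(?f has_field_derivative y / (2 * real N + 1) * Im (pade_defect N y)) (at y)" for y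
    using bounded_linear.has_vector_derivative[OF bounded_linear_Im pade_defect_Suc_has_derivative[of N y]]
    by (simp add: has_real_derivative_iff_has_vector_derivative)
  have bd: "norm (y / (2 * real N + 1) * Im (pade_defect N y)) \<le> \<bar>x\<bar> ^ (2 * N + 2)"
    if "y \<in> {-\<bar>x\<bar>..\<bar>x\<bar>}" for y
  proof -
    have y: "\<bar>y\<bar> \<le> \<bar>x\<bar>"
      using that by auto
    have "\<bar>y / (2 * real N + 1)\<bar> \<le> \<bar>y\<bar>"
      by (simp add: divide_le_eq mult_left_le mult_le_cancel_left1)
    then have "norm (y / (2 * real N + 1) * Im (pade_defect N y)) \<le> \<bar>x\<bar> * \<bar>x\<bar> ^ (2 * N + 1)"
      unfolding real_norm_def abs_mult
      using y Suc.IH[of y] power_mono[OF y, of "2 * N + 1"]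
      by (intro mult_mono) auto
    then show ?thesis
      by simp
  qed
  \<comment> \<open>The mean value theorem between 0 and \<open>x\<close>, stated on a symmetric
    interval to serve both signs of \<open>x\<close>.\<close>
  have "\<exists>y \<in> {-\<bar>x\<bar>..\<bar>x\<bar>}. \<bar>?f x - ?f 0\<bar> = \<bar>x\<bar> * \<bar>y / (2 * real N + 1) * Im (pade_defect N y)\<bar>"
  proof (cases x "0 :: real" rule: linorder_cases)
    case less
    from MVT2[OF this d] obtain y where "x < y" "y < 0"
      "?f 0 - ?f x = (0 - x) * (y / (2 * real N + 1) * Im (pade_defect N y))" by blast
    with less show ?thesis
      by (intro bexI[of _ y]) (auto simp: abs_minus_commute[of "?f x"] abs_mult)
  next
    case greater
    from MVT2[OF this d] obtain y where "0 < y" "y < x"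
      "?f x - ?f 0 = (x - 0) * (y / (2 * real N + 1) * Im (pade_defect N y))" by blast
    with greater show ?thesis
      by (intro bexI[of _ y]) (auto simp: abs_mult)
  qed auto
  then obtain y where y: "y \<in> {-\<bar>x\<bar>..\<bar>x\<bar>}"
    "\<bar>?f x - ?f 0\<bar> = \<bar>x\<bar> * \<bar>y / (2 * real N + 1) * Im (pade_defect N y)\<bar>" by blast
  have "\<bar>?f x - ?f 0\<bar> \<le> \<bar>x\<bar> * \<bar>x\<bar> ^ (2 * N + 2)"
    unfolding y(2) using bd[OF y(1), unfolded real_norm_def] by (intro mult_left_mono abs_ge_zero)
  moreover have "?f 0 = 0"
    by (simp add: pade_defect_def pade_num_def power_0_left)
  ultimately show ?case
    by simp
qed

lemma pade_defect_0: "pade_defect n 0 = 1"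
  by (simp add: pade_defect_def pade_num_def power_0_left if_distrib sum.delta cong: if_cong)

lemma norm_pade_defect: "cmod (pade_defect n x) = cmod (pade_num n (\<i> * complex_of_real x))"
  by (simp add: pade_defect_def norm_mult)

text \<open>By continuity from the value 1 at 0. Near 0 this bounds the modulus of
  \<open>\<Theta>(i x)\<close> away from zero and excludes a phase near \<pi>, which a small
  imaginary part alone would allow.\<close>

lemma eventually_Re_pade_defect: "\<forall>\<^sub>F x in nhds 0. Re (pade_defect n x) > 1 / 2"
proof -
  have "continuous_on UNIV (\<lambda>x. Re (pade_defect n x))"
    unfolding pade_defect_def pade_num_def by (intro continuous_intros)
  then have "isCont (\<lambda>x. Re (pade_defect n x)) 0"
    by (simp add: continuous_on_eq_continuous_at)
  then have "((\<lambda>x. Re (pade_defect n x)) \<longlongrightarrow> 1) (nhds 0)"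
    using tendsto_at_iff_tendsto_nhds[of "\<lambda>x. Re (pade_defect n x)" 0]
    by (simp add: isCont_def pade_defect_0)
  then show ?thesis
    by (rule order_tendstoD) simp
qed

text \<open>With \<open>y = x\<^sup>2\<close> this is the real part of \<open>\<Theta>(i x)\<close>.
  It approximates the cosine to the required order only after division by
  \<open>pade_norm\<close>.\<close>

definition pade_cos :: "nat \<Rightarrow> real \<Rightarrow> real" where
  "pade_cos n y = (\<Sum>j\<le>n div 2. acoef n (2 * j) * (- y) ^ j)"

definition pade_sinc :: "nat \<Rightarrow> real \<Rightarrow> real" where
  "pade_sinc n y = (\<Sum>j<(n + 1) div 2. acoef n (2 * j + 1) * (- y) ^ j)"

lemma poly_alpha_poly: "poly (alpha_poly n) (complex_of_real y) = complex_of_real (pade_cos n y)"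
  by (simp add: alpha_poly_def pade_cos_def poly_sum)

lemma poly_beta_poly: "poly (beta_poly n) (complex_of_real y) = complex_of_real (pade_sinc n y)"
  by (simp add: beta_poly_def pade_sinc_def poly_sum)

lemma sum_even_odd:
  fixes f :: "nat \<Rightarrow> 'a :: comm_monoid_add"
  shows "(\<Sum>k\<le>n. f k) = (\<Sum>j\<le>n div 2. f (2 * j)) + (\<Sum>j<(n + 1) div 2. f (2 * j + 1))"
proof (induction n)
  case (Suc n)
  show ?case
  proof (cases "even n")
    case True
    then obtain q where "n = 2 * q" by (elim evenE)
    then show ?thesis using Suc by (simp add: add_ac)
  next
    case False
    then obtain q where "n = 2 * q + 1" by (elim oddE)
    then show ?thesis using Suc by (simp add: add_ac)
  qed
qed simp

lemma pade_num_imaginary: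
  "pade_num n (\<i> * complex_of_real x) = Complex (pade_cos n (x\<^sup>2)) (x * pade_sinc n (x\<^sup>2))"
proof -
  have e: "(\<i> * complex_of_real x) ^ (2 * j) = complex_of_real ((- (x\<^sup>2)) ^ j)" for j
    unfolding power_mult by (simp add: power_mult_distrib)
  have o: "(\<i> * complex_of_real x) ^ (2 * j + 1) = \<i> * complex_of_real (x * (- (x\<^sup>2)) ^ j)" for j
    unfolding power_add e by simp
  have "pade_num n (\<i> * complex_of_real x)
      = complex_of_real (pade_cos n (x\<^sup>2)) + \<i> * complex_of_real (x * pade_sinc n (x\<^sup>2))"
    unfolding pade_num_def pade_cos_def pade_sinc_def sum_even_odd[of _ n] e o
    by (simp add: sum_distrib_left mult_ac)
  then show ?thesis
    by (simp add: complex_eq_iff)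
qed

definition pade_norm :: "nat \<Rightarrow> real \<Rightarrow> real" where
  "pade_norm n x = cmod (pade_num n (\<i> * complex_of_real x))"

lemma pade_norm_squared: "(pade_norm n x)\<^sup>2 = (pade_cos n (x\<^sup>2))\<^sup>2 + x\<^sup>2 * (pade_sinc n (x\<^sup>2))\<^sup>2"
  unfolding pade_norm_def pade_num_imaginary by (simp add: cmod_def power_mult_distrib)

text \<open>Real and imaginary parts of one complex estimate for
  \<open>exp(i x) - \<Theta>(i x) / r\<close>, with \<open>r\<close> the modulus of
  \<open>\<Theta>(i x)\<close>. The second bound keeps the factor \<open>x\<close>, which avoids a
  division at \<open>x = 0\<close>.\<close>

lemma eventually_pade_bound:
  "\<forall>\<^sub>F x in nhds 0. pade_norm n x > 0 \<and>
     \<bar>cos x - pade_cos n (x\<^sup>2) / pade_norm n x\<bar> \<le> 4 * \<bar>x\<bar> ^ (2 * n + 1) \<and>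
     \<bar>sin x - x * pade_sinc n (x\<^sup>2) / pade_norm n x\<bar> \<le> 4 * \<bar>x\<bar> ^ (2 * n + 1)"
  using eventually_Re_pade_defect[of n]
proof eventually_elim
  case (elim x)
  let ?f = "pade_defect n x" and ?r = "pade_norm n x"
  let ?F = "pade_num n (\<i> * complex_of_real x)"
  have rf: "?r = cmod ?f"
    by (simp add: pade_norm_def norm_pade_defect)
  have r: "?r > 1 / 2"
    using elim complex_Re_le_cmod[of ?f] rf by linarith
  \<comment> \<open>As \<open>Re ?f\<close> is positive,
    \<open>Re ?f \<le> ?r \<le> Re ?f + \<bar>Im ?f\<bar>\<close>, so the distance to the modulus is
    controlled by the imaginary part alone.\<close>
  have "cmod (complex_of_real ?r - ?f) \<le> 2 * \<bar>Im ?f\<bar>"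
  proof -
    have "cmod (complex_of_real ?r - ?f) \<le> \<bar>?r - Re ?f\<bar> + \<bar>Im ?f\<bar>"
      using cmod_le[of "complex_of_real ?r - ?f"] by simp
    moreover have "?r \<le> Re ?f + \<bar>Im ?f\<bar>" "Re ?f \<le> ?r"
      using cmod_le[of ?f] elim complex_Re_le_cmod[of ?f] by (simp_all add: rf)
    ultimately show ?thesis by linarith
  qed
  also have "\<dots> \<le> 2 * \<bar>x\<bar> ^ (2 * n + 1)"
    using abs_Im_pade_defect_le[of n x] by simp
  finally have b: "cmod (complex_of_real ?r - ?f) \<le> 2 * \<bar>x\<bar> ^ (2 * n + 1)" .
  have "exp (\<i> * complex_of_real x) * ?f = ?F"
    unfolding pade_defect_def by (simp add: exp_minus flip: mult.assoc)
  then have "exp (\<i> * complex_of_real x) - ?F / complex_of_real ?r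
      = exp (\<i> * complex_of_real x) * (complex_of_real ?r - ?f) / complex_of_real ?r"
    using r by (simp add: right_diff_distrib diff_divide_distrib)
  then have "cmod (exp (\<i> * complex_of_real x) - ?F / complex_of_real ?r)
      = cmod (complex_of_real ?r - ?f) / ?r"
    using r by (simp add: norm_mult norm_divide)
  \<comment> \<open>The constant 4 is 2 from the distance to the modulus, divided by the lower bound
    1/2 for \<open>?r\<close>.\<close>
  also have "\<dots> \<le> 2 * \<bar>x\<bar> ^ (2 * n + 1) / (1 / 2)"
    using b r by (intro frac_le) auto
  finally have B: "cmod (exp (\<i> * complex_of_real x) - ?F / complex_of_real ?r) \<le> 4 * \<bar>x\<bar> ^ (2 * n + 1)"
    by simp
  moreover have "Re (exp (\<i> * complex_of_real x) - ?F / complex_of_real ?r) = cos x - pade_cos n (x\<^sup>2) / ?r"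
    "Im (exp (\<i> * complex_of_real x) - ?F / complex_of_real ?r) = sin x - x * pade_sinc n (x\<^sup>2) / ?r"
    unfolding pade_num_imaginary by (simp_all add: Re_exp Im_exp)
  ultimately show ?case
    using r abs_Re_le_cmod[of "exp (\<i> * complex_of_real x) - ?F / complex_of_real ?r"]
      abs_Im_le_cmod[of "exp (\<i> * complex_of_real x) - ?F / complex_of_real ?r"] by auto
qed

section \<open>Comparison of the two maps\<close>

text \<open>The eigenvalues of \<open>H\<^sup>* H\<close> are the squared lengths of the columns of
  \<open>H * Q\<close>. They are therefore nonnegative, their roots \<open>s l\<close> are the
  singular values of \<open>H\<close>, and a zero singular value forces a zero column.\<close>

lemma gram_spectral:
  assumes H: "H \<in> carrier_mat m p"
  obtains Q s where "Q \<in> carrier_mat p p" "mat_adjoint Q * Q = 1\<^sub>m p"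
    "mat_adjoint H * H = conj_diag Q (\<lambda>l. complex_of_real ((s l)\<^sup>2))"
    "\<And>i l. i < m \<Longrightarrow> l < p \<Longrightarrow> s l = 0 \<Longrightarrow> (H * Q) $$ (i, l) = 0"
proof -
  have HH: "mat_adjoint H * H \<in> carrier_mat p p"
    using H by auto
  have "mat_adjoint (mat_adjoint H * H) = mat_adjoint H * H"
    using H by (simp add: mat_adjoint_mult[of _ p m _ p])
  from hermitian_spectral[OF HH this] obtain Q d where Q: "Q \<in> carrier_mat p p"
    and QQ: "mat_adjoint Q * Q = 1\<^sub>m p"
    and eq: "mat_adjoint H * H = conj_diag Q (\<lambda>l. complex_of_real (d l))" by blast
  have left: "mat_adjoint Q * (Q * X) = X" if "X \<in> carrier_mat p p" for X
    using that Q QQ by (subst assoc_mult_mat[symmetric, of _ p p _ p _ p]) auto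
  have HQ: "H * Q \<in> carrier_mat m p"
    using H Q by auto
  have "mat_adjoint (H * Q) * (H * Q) = mat_adjoint Q * (mat_adjoint H * H * Q)"
    using H Q
    by (simp add: mat_adjoint_mult[of _ m p _ p] assoc_mult_mat[of _ p p _ m _ p] assoc_mult_mat[of _ p m _ p _ p])
  also have "\<dots> = mat_diag p (\<lambda>l. complex_of_real (d l))"
    unfolding eq conj_diag_def using Q QQ
    by (simp add: assoc_mult_mat[of _ p p _ p _ p] mult_carrier_mat[of _ p p _ p] right_mult_one_mat[of _ p p] left)
  finally have G: "mat_adjoint (H * Q) * (H * Q) = mat_diag p (\<lambda>l. complex_of_real (d l))" .
  have d: "d l = (\<Sum>i<m. (cmod ((H * Q) $$ (i, l)))\<^sup>2)" if l: "l < p" for l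
  proof -
    have "complex_of_real (d l) = (mat_adjoint (H * Q) * (H * Q)) $$ (l, l)"
      unfolding G using l by (simp add: mat_diag_def)
    also have "\<dots> = (\<Sum>i<m. cnj ((H * Q) $$ (i, l)) * (H * Q) $$ (i, l))"
    proof -
      have "(mat_adjoint B * B) $$ (l, l) = (\<Sum>i<m. cnj (B $$ (i, l)) * B $$ (i, l))"
        if "B \<in> carrier_mat m p" for B
        using that l by (simp add: scalar_prod_def lessThan_atLeast0)
      from this[OF HQ] show ?thesis .
    qed
    also have "\<dots> = complex_of_real (\<Sum>i<m. (cmod ((H * Q) $$ (i, l)))\<^sup>2)"
      unfolding of_real_sum by (simp only: complex_norm_square mult.commute)
    finally show ?thesis
      by (simp only: of_real_eq_iff)
  qed
  have d0: "d l \<ge> 0" if "l < p" for l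
    unfolding d[OF that] by (intro sum_nonneg) simp
  show ?thesis
  proof (rule that[OF Q QQ, of "\<lambda>l. sqrt (d l)"])
    show "mat_adjoint H * H = conj_diag Q (\<lambda>l. complex_of_real ((sqrt (d l))\<^sup>2))"
      unfolding eq using d0 by (intro conj_diag_cong[OF Q]) simp
    fix i l assume il: "i < m" "l < p" "sqrt (d l) = 0"
    then have "(\<Sum>i<m. (cmod ((H * Q) $$ (i, l)))\<^sup>2) = 0"
      using d[OF il(2)] by simp
    then have "(cmod ((H * Q) $$ (i, l)))\<^sup>2 = 0"
      using il(1) by (subst (asm) sum_nonneg_eq_0_iff) auto
    then show "(H * Q) $$ (i, l) = 0"
      by simp
  qed
qed

theorem theorem2p3:
  fixes m p n :: nat and Y H :: "complex mat"
  assumes "p \<le> m"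
    and "Y \<in> carrier_mat m p"
    and "orthonormal_cols Y"
    and "H \<in> tangent_Gr Y"
  shows "(\<lambda>t::real. frob_norm
      (exp_Gr Y (complex_of_real t \<cdot>\<^sub>m H)
       - polar_factor
          (Y * mat_poly (alpha_poly n) (complex_of_real (t\<^sup>2) \<cdot>\<^sub>m (mat_adjoint H * H))
           + complex_of_real t \<cdot>\<^sub>m H
             * mat_poly (beta_poly n) (complex_of_real (t\<^sup>2) \<cdot>\<^sub>m (mat_adjoint H * H)))))
    \<in> O[at 0](\<lambda>t. t ^ (2 * n + 1))"
proof -
  note pm = assms(1) and Y = assms(2) and HT = assms(4)
  have YY: "mat_adjoint Y * Y = 1\<^sub>m p"
    using assms(3) Y unfolding orthonormal_cols_def by simp
  note H = tangent_Gr_D(1)[OF Y pm HT] and YH = tangent_Gr_D(2)[OF Y pm HT]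
  obtain Q s where Q: "Q \<in> carrier_mat p p" and QQ: "mat_adjoint Q * Q = 1\<^sub>m p"
    and HH: "mat_adjoint H * H = conj_diag Q (\<lambda>l. complex_of_real ((s l)\<^sup>2))"
    and s0: "\<And>i l. i < m \<Longrightarrow> l < p \<Longrightarrow> s l = 0 \<Longrightarrow> (H * Q) $$ (i, l) = 0"
    using gram_spectral[OF H] by blast
  define err where "err t = exp_Gr Y (complex_of_real t \<cdot>\<^sub>m H)
       - polar_factor
          (Y * mat_poly (alpha_poly n) (complex_of_real (t\<^sup>2) \<cdot>\<^sub>m (mat_adjoint H * H))
           + complex_of_real t \<cdot>\<^sub>m H
             * mat_poly (beta_poly n) (complex_of_real (t\<^sup>2) \<cdot>\<^sub>m (mat_adjoint H * H)))" for t :: real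
  \<comment> \<open>The implied constant for entry \<open>(i, j)\<close>, free of \<open>t\<close>.
    For \<open>s l = 0\<close> the quotient by \<open>\<bar>s l\<bar>\<close> is 0 by convention,
    which is harmless because that column of \<open>H * Q\<close> vanishes.\<close>
  define C where "C i j = (\<Sum>l<p. cmod ((Y * Q) $$ (i, l)) * (4 * \<bar>s l\<bar> ^ (2 * n + 1)) * cmod (Q $$ (j, l)))
    + (\<Sum>l<p. cmod ((H * Q) $$ (i, l)) / \<bar>s l\<bar> * (4 * \<bar>s l\<bar> ^ (2 * n + 1)) * cmod (Q $$ (j, l)))" for i j
  define good where "good x \<longleftrightarrow> pade_norm n x > 0 \<and>
     \<bar>cos x - pade_cos n (x\<^sup>2) / pade_norm n x\<bar> \<le> 4 * \<bar>x\<bar> ^ (2 * n + 1) \<and>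
     \<bar>sin x - x * pade_sinc n (x\<^sup>2) / pade_norm n x\<bar> \<le> 4 * \<bar>x\<bar> ^ (2 * n + 1)" for x
  have "\<forall>\<^sub>F t in at 0. good (t * s l)" for l
  proof -
    have "((\<lambda>t. t * s l) \<longlongrightarrow> 0) (at 0)"
      by (auto intro!: tendsto_eq_intros)
    then show ?thesis
      using eventually_pade_bound[of n] unfolding filterlim_iff good_def by blast
  qed
  \<comment> \<open>There are finitely many singular values, so one neighbourhood of 0 serves all of
    them.\<close>
  then have "\<forall>\<^sub>F t in at 0. \<forall>l\<in>{..<p}. good (t * s l)"
    by (intro eventually_ball_finite) auto
  then have "\<forall>\<^sub>F t in at 0. frob_norm (err t) \<le> (\<Sum>i<m. \<Sum>j<p. C i j) * \<bar>t\<bar> ^ (2 * n + 1)"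
  proof eventually_elim
    case (elim t)
    note elim = elim[unfolded good_def]
    let ?x = "\<lambda>l. t * s l"
    let ?r = "\<lambda>l. pade_norm n (?x l)"
    let ?H = "complex_of_real t \<cdot>\<^sub>m H"
    have tH: "?H \<in> carrier_mat m p"
      using H by simp
    have tHT: "?H \<in> tangent_Gr Y"
      using tangent_Gr_smult[OF Y HT] .
    have YtH: "mat_adjoint Y * ?H = 0\<^sub>m p p"
      using tangent_Gr_D(2)[OF Y pm tHT] .
    \<comment> \<open>Both maps are now evaluated in the same basis \<open>Q\<close> at the points
      \<open>t * s l\<close>.\<close>
    have t2: "complex_of_real (t\<^sup>2) \<cdot>\<^sub>m (mat_adjoint H * H) = conj_diag Q (\<lambda>l. complex_of_real ((?x l)\<^sup>2))"
      unfolding HH conj_diag_smult[OF Q] by (simp add: power_mult_distrib)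
    have "mat_adjoint ?H * ?H = complex_of_real (t\<^sup>2) \<cdot>\<^sub>m (mat_adjoint H * H)"
      using H by (intro eq_matI) (auto simp: mat_adjoint_smult mult_smult_distrib[of _ p m _ p]
          mult_smult_assoc_mat[of _ p m _ p] power2_eq_square)
    then have tHH: "mat_adjoint ?H * ?H = conj_diag Q (\<lambda>l. complex_of_real ((?x l)\<^sup>2))"
      unfolding t2 .
    have P: "polar_factor (Y * conj_diag Q (\<lambda>l. complex_of_real (pade_cos n ((?x l)\<^sup>2)))
          + ?H * conj_diag Q (\<lambda>l. complex_of_real (pade_sinc n ((?x l)\<^sup>2))))
        = Y * conj_diag Q (\<lambda>l. complex_of_real (pade_cos n ((?x l)\<^sup>2) / ?r l))
          + ?H * conj_diag Q (\<lambda>l. complex_of_real (pade_sinc n ((?x l)\<^sup>2) / ?r l))"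
      using elim by (intro polar_factor_conj_diag[OF Y YY tH YtH Q QQ tHH]) (simp add: pade_norm_squared)
    have err: "err t = (Y * conj_diag Q (\<lambda>l. complex_of_real (cos (?x l))) + ?H * conj_diag Q (\<lambda>l. complex_of_real (sinc (?x l))))
        - (Y * conj_diag Q (\<lambda>l. complex_of_real (pade_cos n ((?x l)\<^sup>2) / ?r l))
          + ?H * conj_diag Q (\<lambda>l. complex_of_real (pade_sinc n ((?x l)\<^sup>2) / ?r l)))"
      unfolding err_def t2 mat_poly_conj_diag[OF Q QQ] poly_alpha_poly poly_beta_poly P
        exp_Gr_eq[OF Y pm tHT Q QQ tHH] ..
    have dim: "dim_row (err t) = m" "dim_col (err t) = p"
      unfolding err using Q H by simp_all
    have "cmod (err t $$ (i, j)) \<le> C i j * \<bar>t\<bar> ^ (2 * n + 1)" if ij: "i < m" "j < p" for i j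
    proof -
      let ?f = "\<lambda>l. cos (?x l) - pade_cos n ((?x l)\<^sup>2) / ?r l"
      let ?g = "\<lambda>l. sinc (?x l) - pade_sinc n ((?x l)\<^sup>2) / ?r l"
      have HQ: "(?H * Q) $$ (i, l) = complex_of_real t * (H * Q) $$ (i, l)" if "l < p" for l
        using H Q ij that by (simp add: mult_smult_assoc_mat[of _ m p _ p] del: index_mult_mat(1))
      have carr: "Y * conj_diag Q F \<in> carrier_mat m p" "?H * conj_diag Q F \<in> carrier_mat m p" for F
        using Y H Q by auto
      have "err t $$ (i, j) = ((Y * conj_diag Q (\<lambda>l. complex_of_real (cos (?x l)))) $$ (i, j)
          - (Y * conj_diag Q (\<lambda>l. complex_of_real (pade_cos n ((?x l)\<^sup>2) / ?r l))) $$ (i, j))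
        + ((?H * conj_diag Q (\<lambda>l. complex_of_real (sinc (?x l)))) $$ (i, j)
          - (?H * conj_diag Q (\<lambda>l. complex_of_real (pade_sinc n ((?x l)\<^sup>2) / ?r l))) $$ (i, j))"
        unfolding err using carr ij Q H by (simp del: index_mult_mat(1))
      also have "\<dots> = (\<Sum>l<p. (Y * Q) $$ (i, l) * complex_of_real (?f l) * cnj (Q $$ (j, l)))
          + (\<Sum>l<p. (?H * Q) $$ (i, l) * complex_of_real (?g l) * cnj (Q $$ (j, l)))"
        unfolding mult_conj_diag_index[OF Q Y ij] mult_conj_diag_index[OF Q tH ij] sum_subtractf[symmetric]
        by (simp only: of_real_diff right_diff_distrib left_diff_distrib)
      finally have "cmod (err t $$ (i, j)) \<le>
          cmod (\<Sum>l<p. (Y * Q) $$ (i, l) * complex_of_real (?f l) * cnj (Q $$ (j, l)))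
          + cmod (\<Sum>l<p. (?H * Q) $$ (i, l) * complex_of_real (?g l) * cnj (Q $$ (j, l)))"
        by (simp only: norm_triangle_ineq)
      also have "\<dots> \<le> (\<Sum>l<p. cmod ((Y * Q) $$ (i, l)) * (4 * \<bar>s l\<bar> ^ (2 * n + 1)) * cmod (Q $$ (j, l)) * \<bar>t\<bar> ^ (2 * n + 1))
          + (\<Sum>l<p. cmod ((H * Q) $$ (i, l)) / \<bar>s l\<bar> * (4 * \<bar>s l\<bar> ^ (2 * n + 1)) * cmod (Q $$ (j, l)) * \<bar>t\<bar> ^ (2 * n + 1))"
      proof (intro add_mono sum_norm_le)
        fix l assume "l \<in> {..<p}"
        then have l: "l < p" by simp
        have "cmod ((Y * Q) $$ (i, l) * complex_of_real (?f l) * cnj (Q $$ (j, l)))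
            = cmod ((Y * Q) $$ (i, l)) * \<bar>?f l\<bar> * cmod (Q $$ (j, l))"
          by (simp only: norm_mult norm_of_real complex_mod_cnj)
        also have "\<dots> \<le> cmod ((Y * Q) $$ (i, l)) * (4 * \<bar>?x l\<bar> ^ (2 * n + 1)) * cmod (Q $$ (j, l))"
          using elim l by (intro mult_right_mono mult_left_mono) auto
        also have "\<dots> = cmod ((Y * Q) $$ (i, l)) * (4 * \<bar>s l\<bar> ^ (2 * n + 1)) * cmod (Q $$ (j, l)) * \<bar>t\<bar> ^ (2 * n + 1)"
          unfolding abs_mult power_mult_distrib by (simp only: mult_ac)
        finally show "cmod ((Y * Q) $$ (i, l) * complex_of_real (?f l) * cnj (Q $$ (j, l)))
            \<le> cmod ((Y * Q) $$ (i, l)) * (4 * \<bar>s l\<bar> ^ (2 * n + 1)) * cmod (Q $$ (j, l)) * \<bar>t\<bar> ^ (2 * n + 1)" .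
        show "cmod ((?H * Q) $$ (i, l) * complex_of_real (?g l) * cnj (Q $$ (j, l)))
            \<le> cmod ((H * Q) $$ (i, l)) / \<bar>s l\<bar> * (4 * \<bar>s l\<bar> ^ (2 * n + 1)) * cmod (Q $$ (j, l)) * \<bar>t\<bar> ^ (2 * n + 1)"
        proof (cases "s l = 0")
          case True
          then show ?thesis
            unfolding HQ[OF l] s0[OF ij(1) l True] by simp
        next
          case False
          \<comment> \<open>The sine estimate controls \<open>?g l\<close> only after multiplication
            by \<open>t * s l\<close>: the factor \<open>t\<close> is supplied by the scaled tangent
            vector, and \<open>s l\<close> is divided out into the constant.\<close>
          have "s l * (t * ?g l) = ?x l * sinc (?x l) - ?x l * pade_sinc n ((?x l)\<^sup>2) / ?r l"
            by (simp add: right_diff_distrib mult_ac del: mult_sinc)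
          then have "s l * (t * ?g l) = sin (?x l) - ?x l * pade_sinc n ((?x l)\<^sup>2) / ?r l"
            unfolding mult_sinc .
          then have "\<bar>s l\<bar> * \<bar>t * ?g l\<bar> \<le> 4 * \<bar>?x l\<bar> ^ (2 * n + 1)"
            using elim l unfolding abs_mult[symmetric] by simp
          then have tg: "\<bar>t * ?g l\<bar> \<le> 4 * \<bar>?x l\<bar> ^ (2 * n + 1) / \<bar>s l\<bar>"
            using False by (simp add: pos_le_divide_eq mult.commute)
          have "cmod ((?H * Q) $$ (i, l) * complex_of_real (?g l) * cnj (Q $$ (j, l)))
              = cmod ((H * Q) $$ (i, l)) * \<bar>t * ?g l\<bar> * cmod (Q $$ (j, l))"
            unfolding HQ[OF l] by (simp only: norm_mult norm_of_real complex_mod_cnj abs_mult mult_ac)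
          also have "\<dots> \<le> cmod ((H * Q) $$ (i, l)) * (4 * \<bar>?x l\<bar> ^ (2 * n + 1) / \<bar>s l\<bar>) * cmod (Q $$ (j, l))"
            using tg by (intro mult_right_mono mult_left_mono) auto
          also have "\<dots> = cmod ((H * Q) $$ (i, l)) / \<bar>s l\<bar> * (4 * \<bar>s l\<bar> ^ (2 * n + 1)) * cmod (Q $$ (j, l)) * \<bar>t\<bar> ^ (2 * n + 1)"
            unfolding abs_mult power_mult_distrib by (simp only: mult_ac times_divide_eq_right times_divide_eq_left)
          finally show ?thesis .
        qed
      qed
      also have "\<dots> = C i j * \<bar>t\<bar> ^ (2 * n + 1)"
        unfolding C_def by (simp only: sum_distrib_right distrib_right)
      finally show ?thesis .
    qed
    then have "(\<Sum>i<m. \<Sum>j<p. cmod (err t $$ (i, j))) \<le> (\<Sum>i<m. \<Sum>j<p. C i j * \<bar>t\<bar> ^ (2 * n + 1))"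
      by (intro sum_mono) auto
    then show ?case
      using frob_norm_le_sum[of "err t"] unfolding dim by (simp add: sum_distrib_right)
  qed
  \<comment> \<open>The exponent is odd, so the comparison function is negative for
    \<open>t < 0\<close>; only its absolute value enters.\<close>
  then have "(\<lambda>t. frob_norm (err t)) \<in> O[at 0](\<lambda>t. t ^ (2 * n + 1))"
  proof (intro bigoI[where c = "\<Sum>i<m. \<Sum>j<p. C i j"], elim eventually_mono)
    fix t assume "frob_norm (err t) \<le> (\<Sum>i<m. \<Sum>j<p. C i j) * \<bar>t\<bar> ^ (2 * n + 1)"
    moreover have "frob_norm (err t) \<ge> 0"
      unfolding frob_norm_def by (intro real_sqrt_ge_zero sum_nonneg) simp
    ultimately show "norm (frob_norm (err t)) \<le> (\<Sum>i<m. \<Sum>j<p. C i j) * norm (t ^ (2 * n + 1))"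
      by (simp only: real_norm_def power_abs abs_of_nonneg)
  qed
  then show ?thesis
    unfolding err_def .
qed

end
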